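(* Let $\mathcal{S}=\{S_l\}_{l\in\mathcal{I}}$ be a cell decomposition of $D$ with diameter $d_{\max}:=\sup\{\mathrm{diam}(S_l):l\in\mathcal{I}\}$, let $\delta t>0$ be a time step, let $\lambda\in(0,1)$, $\mu>0$, let $W:=B(\lambda v_{\max})$ and $$L:=\max\{3L_2+4L_1\sqrt{N_i}: i\in\mathcal{N}\}.$$ Assume that $\lambda,\mu,d_{\max},\delta t$ satisfy one of the following: Case I: $0\le\mu\le\frac{2\lambda}{1-\lambda}$, and (a) $d_{\max}\in\left(0,\frac{(1-\lambda)^2v_{\max}^2}{4ML}\right]$, (b) $\delta t\in\left[\frac{(1-\lambda)v_{\max}-\sqrt{(1-\lambda)^2v_{\max}^2-4MLd_{\max}}}{2ML},\frac{(1-\lambda)v_{\max}+\sqrt{(1-\lambda)^2v_{\max}^2-4MLd_{\max}}}{2ML}\right]$. Case II: $\frac{2\lambda}{1-\lambda}<\mu<\frac{4\lambda}{1-\lambda}$, and either (c) $d_{\max}\in\left(0,\frac{2(\lambda(1-\lambda)\mu-2\lambda^2)v_{\max}^2}{\mu^2ML}\right]$ and (d) $\delta t\in\left[\frac{\mu}{2\lambda v_{\max}}d_{\max},\frac{(1-\lambda)v_{\max}+\sqrt{(1-\lambda)^2v_{\max}^2-4MLd_{\max}}}{2ML}\right]$, or $d_{\max}\in\left(\frac{2(\lambda(1-\lambda)\mu-2\lambda^2)v_{\max}^2}{\mu^2ML},\frac{(1-\lambda)^2v_{\max}^2}{4ML}\right]$ and $\delta t$ satisfies (b). Case III: $\mu\ge\frac{4\lambda}{1-\lambda}$,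 and $d_{\max}$, $\delta t$ satisfy (c) and (d). Then for each agent $i\in\mathcal{N}$ and each cell configuration $\mathbf{l}_i=(l_i,l_{j_1},\ldots,l_{j_{N_i}})\in\mathcal{I}^{N_i+1}$ of $i$ we have $\mathrm{Post}_i(l_i;\mathbf{l}_i)\ne\emptyset$, i.e. the space-time discretization $\mathcal{S}-\delta t$ is well posed for the multi-agent system. In particular, for any tuple of reference points $(x_{i,G},\mathbf{x}_{j,G})\in S_{l_i}\times(S_{l_{j_1}}\times\cdots\times S_{l_{j_{N_i}}})$ and corresponding reference trajectory $\chi_i(\cdot)$ of $i$, it holds $$B(\chi_i(\delta t);r)\subset D,\qquad \mathrm{Post}_i(l_i;\mathbf{l}_i)\supset\{l\in\mathcal{I}:S_l\cap B(\chi_i(\delta t);r)\ne\emptyset\},$$ where $r:=\lambda v_{\max}\delta t$.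
   Context: Notation: $|\cdot|$ is the Euclidean norm; $B(R)$ and $B(x;R)$ are the closed balls of radius $R$ centered at $0$ and at $x$ in $\mathbb{R}^n$; $A+B$ is the Minkowski sum; $\mathrm{cl}(S)$ and $\mathrm{int}(S)$ are the closure and interior of $S\subset\mathbb{R}^n$; $\mathrm{diam}(S):=\sup\{|x-y|:x,y\in S\}$. System. $\mathcal{N}=\{1,\ldots,N\}$ is the set of agents; each agent $i$ has a set of neighbors $\mathcal{N}_i\subset\mathcal{N}\setminus\{i\}$ of cardinality $N_i$, ordered as $j_1,\ldots,j_{N_i}$ (depending on $i$; write $j(i)=(j_1,\ldots,j_{N_i})$), and $\mathbf{x}_j=\mathbf{x}_{j(i)}:=(x_{j_1},\ldots,x_{j_{N_i}})$. $D$ is a domain of $\mathbb{R}^n$. The multi-agent system is $\dot x_i=f_i(x_i,\mathbf{x}_j)+v_i$, $x_i\in D$, $i\in\mathcal{N}$, with $f_i:D^{N_i+1}\to\mathbb{R}^n$ and $|f_i|\le M$ on $D^{N_i+1}$; free inputs $v_i$ are piecewise continuous with $|v_i(t)|\le v_{\max}$ for all $t\ge0$; $0<v_{\max}<M$. There are Lipschitz constants $L_1,L_2>0$ with $|f_i(x_i,\mathbf{x}_j)-f_i(x_i,\mathbf{y}_j)|\le L_1|(x_i,\mathbf{x}_j)-(x_i,\mathbf{y}_j)|$ and $|f_i(x_i,\mathbf{x}_j)-f_i(y_i,\mathbf{x}_j)|\le L_2|(x_i,\mathbf{x}_j)-(y_i,\mathbf{x}_j)|$ for all $x_i,y_i\in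 D$, $\mathbf{x}_j,\mathbf{y}_j\in D^{N_i}$, $i\in\mathcal{N}$. Invariance Assumption: for every $x(0)\in D^N$ and every piecewise continuous $v=(v_1,\ldots,v_N):[0,\infty)\to\mathbb{R}^{Nn}$ with $|v_i(t)|\le v_{\max}$ for all $t\ge 0$, $i\in\mathcal{N}$, the unique solution of the system is defined and remains in $D^N$ for all $t\ge0$. Cell decomposition. A cell decomposition of $D$ is a family $\{S_l\}_{l\in\mathcal{I}}$, with $\mathcal{I}$ a finite or countable index set, of nonempty connected sets $S_l$ such that $\sup\{\mathrm{diam}(S_l):l\in\mathcal{I}\}<\infty$, $\mathrm{cl}(\mathrm{int}(S_l))=S_l$ for all $l\in\mathcal{I}$, $\mathrm{int}(S_l)\cap\mathrm{int}(S_{\hat l})=\emptyset$ for all $l\ne\hat l$, and $\bigcup_{l\in\mathcal{I}} S_l=D$. For $\mathbf{l}=(l_1,\ldots,l_N)\in\mathcal{I}^N$ (a cell configuration) put $\mathrm{pr}_i(\mathbf{l}):=(l_i,l_{j_1},\ldots,l_{j_{N_i}})\in\mathcal{I}^{N_i+1}$; elements $\mathbf{l}_i=(l_i,l_{j_1},\ldots,l_{j_{N_i}})$ of $\mathcal{I}^{N_i+1}$ are cell configurations of agent $i$. Property (P). Let $R_{\max}:=\delta t(M+v_{\max})$ and let $W\subset\mathbb{R}^n$ be nonempty. A feedback law for agent $i$ and cell configuration $\mathbf{l}_i$ is a family of times $T(x_{i0},w_i)>0$ (possibly $+\infty$) and maps $k_{i,\mathbf{l}_i}(\cdot;x_{i0},w_i):[0,T(x_{i0},w_i))\times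 D^{N_i+1}\to\mathbb{R}^n$, parameterized by $x_{i0}\in S_{l_i}$, $w_i\in W$. It satisfies Property (P) if: (P1) each $k_{i,\mathbf{l}_i}(\cdot;x_{i0},w_i)$ is locally Lipschitz continuous; (P2) $|k_{i,\mathbf{l}_i}(t,x_i,\mathbf{x}_j;x_{i0},w_i)|\le v_{\max}$ for all $t\in[0,\delta t]\cap[0,T(x_{i0},w_i))$, $x_i\in(S_{l_i}+B(R_{\max}))\cap D$, $x_{j_m}\in(S_{l_{j_m}}+B(R_{\max}))\cap D$ ($m=1,\ldots,N_i$), $x_{i0}\in S_{l_i}$, $w_i\in W$; (P3) $T(x_{i0},w_i)>\delta t$ for all $x_{i0}\in S_{l_i}$, $w_i\in W$. Condition (C). Given $\mathbf{l}_i$, a feedback law $k_{i,\mathbf{l}_i}$ satisfying (P), $w_i\in W$ and $l_i'\in\mathcal{I}$, Condition (C) holds if for each cell configuration $\mathbf{l}$ with $\mathrm{pr}_i(\mathbf{l})=\mathbf{l}_i$, all feedback laws $k_{\ell,\mathrm{pr}_\ell(\mathbf{l})}$, $\ell\in\mathcal{N}\setminus\{i\}$, satisfying (P), all $w_\ell\in W$ ($\ell\neq i$) and all $x(0)\in D^N$ with $x_m(0)=x_{m0}\in S_{l_m}$ ($m\in\mathcal{N}$), the solution of the closed-loop system with $v_i=k_{i,\mathbf{l}_i}(t,x_i,\mathbf{x}_{j(i)};x_{i0},w_i)$ and $v_\ell=k_{\ell,\mathrm{pr}_\ell(\mathbf{l})}(t,x_\ell,\mathbf{x}_{j(\ell)};x_{\ell0},w_\ell)$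 is well defined on $[0,\delta t]$ and $x_i(\delta t)\in S_{l_i'}$. Well posedness. The transition $l_i\overset{\mathbf{l}_i}{\longrightarrow}l_i'$ is well posed if there exist a feedback law $k_{i,\mathbf{l}_i}$ satisfying (P) and $w_i\in W$ such that $\mathbf{l}_i,k_{i,\mathbf{l}_i},w_i,l_i'$ satisfy (C). $\mathrm{Post}_i(l_i;\mathbf{l}_i)$ is the set of $l_i'\in\mathcal{I}$ for which this transition is well posed. $\mathcal{S}-\delta t$ is well posed if for each $i$ and $\mathbf{l}_i$ at least one such $l_i'$ exists. Here these notions are taken with $W=B(\lambda v_{\max})$. Reference trajectory. For reference points $(x_{i,G},\mathbf{x}_{j,G})$ as in the claim, $\chi_i(\cdot)$ is the solution of $\dot\chi_i=f_i(\chi_i,\mathbf{x}_{j,G})$, $\chi_i(0)=x_{i,G}$, on its maximal right interval of existence in $D$ (under the stated hypotheses this interval contains $[0,\delta t]$). *)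

theory Defs
  imports "HOL-Analysis.Analysis"
begin

text \<open>
  Agents are the elements of a finite type; the state space of one agent is \<open>real^'n\<close>, and the
  stacked state of all agents is a vector of type \<open>real^'n^'k\<close>. The number of neighbors depends on
  the agent, so the tuples $(x_i, x_{j_1}, \ldots, x_{j_{N_i}})$ and
  $(l_i, l_{j_1}, \ldots, l_{j_{N_i}})$ are lists of length $N_i + 1$ with the entry of agent $i$
  at the head. The ordered neighbors of agent $i$ are the list \<open>nb i\<close>.
\<close>

definition tuples :: "'a set \<Rightarrow> nat \<Rightarrow> 'a list set" where
  "tuples A n = {xs. length xs = n \<and> set xs \<subseteq> A}"

text \<open>Euclidean distance of stacked vectors; only meaningful for lists of equal length.\<close>

definition tuple_dist :: "'v::metric_space list \<Rightarrow> 'v list \<Rightarrow> real" where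
  "tuple_dist xs ys = sqrt (\<Sum>m<length xs. (dist (xs ! m) (ys ! m))\<^sup>2)"

definition time_tuple_dist :: "real \<times> 'v::metric_space list \<Rightarrow> real \<times> 'v list \<Rightarrow> real" where
  "time_tuple_dist p q = sqrt ((dist (fst p) (fst q))\<^sup>2 + (tuple_dist (snd p) (snd q))\<^sup>2)"

text \<open>Local Lipschitz continuity jointly in time and state.\<close>

definition locally_lipschitz_tuple ::
  "(real \<times> 'v::metric_space list) set \<Rightarrow> (real \<Rightarrow> 'v list \<Rightarrow> 'v) \<Rightarrow> bool" where
  "locally_lipschitz_tuple A g \<longleftrightarrow>
     (\<forall>p\<in>A. \<exists>e>0. \<exists>C. \<forall>q\<in>A. \<forall>r\<in>A.
        time_tuple_dist p q < e \<longrightarrow> time_tuple_dist p r < e \<longrightarrow>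
        dist (g (fst q) (snd q)) (g (fst r) (snd r)) \<le> C * time_tuple_dist q r)"

text \<open>The projection $\mathrm{pr}_i$, used both for states and for cell configurations.\<close>

definition pr :: "('k \<Rightarrow> 'k list) \<Rightarrow> 'k \<Rightarrow> ('k \<Rightarrow> 'a) \<Rightarrow> 'a list" where
  "pr nb i x = map x (i # nb i)"

text \<open>
  Piecewise continuity on $[0,\infty)$: finitely many discontinuities on each bounded interval,
  with finite one-sided limits.
\<close>

definition piecewise_continuous :: "(real \<Rightarrow> 'b::topological_space) \<Rightarrow> bool" where
  "piecewise_continuous v \<longleftrightarrow>
     (\<forall>b. finite {t\<in>{0..b}. \<not> continuous (at t within {0..}) v}) \<and>
     (\<forall>t\<ge>0. \<exists>a. (v \<longlongrightarrow> a) (at_right t)) \<and>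
     (\<forall>t>0. \<exists>a. (v \<longlongrightarrow> a) (at_left t))"

text \<open>
  Solutions on the interval \<open>J\<close> of $\dot x_i = f_i(x_i, \mathbf{x}_j) + v_i$ that stay in $D^N$.
  For piecewise continuous $v$ the solution is continuous and satisfies the equation at all times at
  which $v$ is continuous, which is equivalent to the integral equation.
\<close>

definition mas_solution ::
  "('k \<Rightarrow> 'k list) \<Rightarrow> ('k \<Rightarrow> (real^'n) list \<Rightarrow> real^'n) \<Rightarrow> (real^'n) set
    \<Rightarrow> (real \<Rightarrow> real^'n^'k) \<Rightarrow> real set \<Rightarrow> (real \<Rightarrow> real^'n^'k) \<Rightarrow> bool" where
  "mas_solution nb f D v J x \<longleftrightarrow>
     continuous_on J x \<and>
     (\<forall>t\<in>J. \<forall>i. x t $ i \<in> D) \<and>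
     (\<forall>t\<in>J. continuous (at t within J) v \<longrightarrow>
        (\<forall>i. ((\<lambda>s. x s $ i) has_vector_derivative (f i (pr nb i (($) (x t))) + v t $ i))
             (at t within J)))"

definition invariance_assumption ::
  "('k::finite \<Rightarrow> 'k list) \<Rightarrow> ('k \<Rightarrow> (real^'n) list \<Rightarrow> real^'n) \<Rightarrow> (real^'n) set
    \<Rightarrow> real \<Rightarrow> bool" where
  "invariance_assumption nb f D vmax \<longleftrightarrow>
     (\<forall>x0 v. (\<forall>i. x0 $ i \<in> D) \<longrightarrow> piecewise_continuous v \<longrightarrow>
        (\<forall>t\<ge>0. \<forall>i. norm (v t $ i) \<le> vmax) \<longrightarrow>
        (\<exists>x. mas_solution nb f D v {0..} x \<and> x 0 = x0 \<and>
           (\<forall>y. mas_solution nb f D v {0..} y \<and> y 0 = x0 \<longrightarrow> (\<forall>t\<ge>0. y t = x t))))"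

definition multi_agent_system ::
  "('k::finite \<Rightarrow> 'k list) \<Rightarrow> ('k \<Rightarrow> (real^'n) list \<Rightarrow> real^'n) \<Rightarrow> (real^'n) set
    \<Rightarrow> real \<Rightarrow> real \<Rightarrow> real \<Rightarrow> real \<Rightarrow> bool" where
  "multi_agent_system nb f D M vmax L1 L2 \<longleftrightarrow>
     (\<forall>i. distinct (nb i) \<and> i \<notin> set (nb i)) \<and>
     open D \<and> connected D \<and> D \<noteq> {} \<and>
     0 < vmax \<and> vmax < M \<and> 0 < L1 \<and> 0 < L2 \<and>
     (\<forall>i. \<forall>z\<in>tuples D (Suc (length (nb i))). norm (f i z) \<le> M) \<and>
     (\<forall>i. \<forall>x\<in>D. \<forall>xs\<in>tuples D (length (nb i)). \<forall>ys\<in>tuples D (length (nb i)).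
        norm (f i (x # xs) - f i (x # ys)) \<le> L1 * tuple_dist (x # xs) (x # ys)) \<and>
     (\<forall>i. \<forall>x\<in>D. \<forall>y\<in>D. \<forall>xs\<in>tuples D (length (nb i)).
        norm (f i (x # xs) - f i (y # xs)) \<le> L2 * tuple_dist (x # xs) (y # xs)) \<and>
     invariance_assumption nb f D vmax"

text \<open>
  Boundedness of the single cells is stated separately because \<^const>\<open>diameter\<close> is real-valued and
  hence not informative on unbounded sets.
\<close>

definition cell_decomposition ::
  "(real^'n) set \<Rightarrow> 'l set \<Rightarrow> ('l \<Rightarrow> (real^'n) set) \<Rightarrow> bool" where
  "cell_decomposition D I S \<longleftrightarrow>
     countable I \<and>
     (\<forall>l\<in>I. S l \<noteq> {} \<and> connected (S l) \<and> bounded (S l)) \<and>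
     bdd_above ((\<lambda>l. diameter (S l)) ` I) \<and>
     (\<forall>l\<in>I. closure (interior (S l)) = S l) \<and>
     (\<forall>l\<in>I. \<forall>l'\<in>I. l \<noteq> l' \<longrightarrow> interior (S l) \<inter> interior (S l') = {}) \<and>
     (\<Union>l\<in>I. S l) = D"

definition d_max :: "'l set \<Rightarrow> ('l \<Rightarrow> (real^'n) set) \<Rightarrow> real" where
  "d_max I S = (SUP l\<in>I. diameter (S l))"

text \<open>
  A feedback law consists of the times \<open>horizon x\<^sub>0 w\<close>, i.e. $T(x_{i0},w_i)$, and the maps
  \<open>feedback x\<^sub>0 w\<close>, i.e. $k_{i,\mathbf{l}_i}(\cdot; x_{i0}, w_i)$; the values of the latter outside
  $[0,T(x_{i0},w_i)) \times D^{N_i+1}$ are irrelevant.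
\<close>

record 'v feedback_law =
  horizon :: "'v \<Rightarrow> 'v \<Rightarrow> ereal"
  feedback :: "'v \<Rightarrow> 'v \<Rightarrow> real \<Rightarrow> 'v list \<Rightarrow> 'v"

definition enlarge :: "'v::real_normed_vector set \<Rightarrow> real \<Rightarrow> 'v set" where
  "enlarge A R = {a + b | a b. a \<in> A \<and> b \<in> cball 0 R}"

text \<open>
  Property (P) for the cell configuration \<open>li\<close> of an agent; the conjuncts are positivity of the
  times $T$, followed by (P1), (P2), (P3).
\<close>

definition property_P ::
  "(real^'n) set \<Rightarrow> ('l \<Rightarrow> (real^'n) set) \<Rightarrow> real \<Rightarrow> real \<Rightarrow> real \<Rightarrow> (real^'n) set
    \<Rightarrow> 'l list \<Rightarrow> (real^'n) feedback_law \<Rightarrow> bool" where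
  "property_P D S M vmax dt W li K \<longleftrightarrow>
     (\<forall>x0\<in>S (hd li). \<forall>w\<in>W.
        0 < horizon K x0 w \<and>
        locally_lipschitz_tuple
          ({t. 0 \<le> t \<and> ereal t < horizon K x0 w} \<times> tuples D (length li)) (feedback K x0 w) \<and>
        (\<forall>t z. 0 \<le> t \<and> t \<le> dt \<and> ereal t < horizon K x0 w \<and> length z = length li \<and>
           (\<forall>m<length li. z ! m \<in> enlarge (S (li ! m)) (dt * (M + vmax)) \<inter> D) \<longrightarrow>
           norm (feedback K x0 w t z) \<le> vmax) \<and>
        horizon K x0 w > ereal dt)"

definition closed_loop_solution ::
  "('k \<Rightarrow> 'k list) \<Rightarrow> ('k \<Rightarrow> (real^'n) list \<Rightarrow> real^'n) \<Rightarrow> (real^'n) set \<Rightarrow> real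
    \<Rightarrow> ('k \<Rightarrow> (real^'n) feedback_law) \<Rightarrow> ('k \<Rightarrow> real^'n) \<Rightarrow> real^'n^'k
    \<Rightarrow> (real \<Rightarrow> real^'n^'k) \<Rightarrow> bool" where
  "closed_loop_solution nb f D dt K w x0 x \<longleftrightarrow>
     x 0 = x0 \<and>
     mas_solution nb f D
       (\<lambda>t. \<chi> m. feedback (K m) (x0 $ m) (w m) t (pr nb m (($) (x t)))) {0..dt} x"

text \<open>
  Condition (C). The families \<open>K\<close> and \<open>w\<close> range over all agents, with their \<open>i\<close>-th members fixed.
\<close>

definition condition_C ::
  "('k \<Rightarrow> 'k list) \<Rightarrow> ('k::finite \<Rightarrow> (real^'n) list \<Rightarrow> real^'n) \<Rightarrow> (real^'n) set
    \<Rightarrow> 'l set \<Rightarrow> ('l \<Rightarrow> (real^'n) set) \<Rightarrow> real \<Rightarrow> real \<Rightarrow> real \<Rightarrow> (real^'n) set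
    \<Rightarrow> 'k \<Rightarrow> 'l list \<Rightarrow> (real^'n) feedback_law \<Rightarrow> real^'n \<Rightarrow> 'l \<Rightarrow> bool" where
  "condition_C nb f D I S M vmax dt W i li Ki wi l' \<longleftrightarrow>
     (\<forall>l K w x0.
        (\<forall>m. l m \<in> I) \<and> pr nb i l = li \<and> K i = Ki \<and> w i = wi \<and>
        (\<forall>m. m \<noteq> i \<longrightarrow> property_P D S M vmax dt W (pr nb m l) (K m) \<and> w m \<in> W) \<and>
        (\<forall>m. x0 $ m \<in> D \<and> x0 $ m \<in> S (l m)) \<longrightarrow>
        (\<exists>x. closed_loop_solution nb f D dt K w x0 x) \<and>
        (\<forall>x. closed_loop_solution nb f D dt K w x0 x \<longrightarrow> x dt $ i \<in> S l'))"

definition well_posed_transition ::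
  "('k \<Rightarrow> 'k list) \<Rightarrow> ('k::finite \<Rightarrow> (real^'n) list \<Rightarrow> real^'n) \<Rightarrow> (real^'n) set
    \<Rightarrow> 'l set \<Rightarrow> ('l \<Rightarrow> (real^'n) set) \<Rightarrow> real \<Rightarrow> real \<Rightarrow> real \<Rightarrow> (real^'n) set
    \<Rightarrow> 'k \<Rightarrow> 'l list \<Rightarrow> 'l \<Rightarrow> bool" where
  "well_posed_transition nb f D I S M vmax dt W i li l' \<longleftrightarrow>
     (\<exists>K. \<exists>w\<in>W. property_P D S M vmax dt W li K \<and>
        condition_C nb f D I S M vmax dt W i li K w l')"

definition Post ::
  "('k \<Rightarrow> 'k list) \<Rightarrow> ('k::finite \<Rightarrow> (real^'n) list \<Rightarrow> real^'n) \<Rightarrow> (real^'n) set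
    \<Rightarrow> 'l set \<Rightarrow> ('l \<Rightarrow> (real^'n) set) \<Rightarrow> real \<Rightarrow> real \<Rightarrow> real \<Rightarrow> (real^'n) set
    \<Rightarrow> 'k \<Rightarrow> 'l list \<Rightarrow> 'l set" where
  "Post nb f D I S M vmax dt W i li =
     {l'\<in>I. well_posed_transition nb f D I S M vmax dt W i li l'}"

definition well_posed_discretization ::
  "('k \<Rightarrow> 'k list) \<Rightarrow> ('k::finite \<Rightarrow> (real^'n) list \<Rightarrow> real^'n) \<Rightarrow> (real^'n) set
    \<Rightarrow> 'l set \<Rightarrow> ('l \<Rightarrow> (real^'n) set) \<Rightarrow> real \<Rightarrow> real \<Rightarrow> real \<Rightarrow> (real^'n) set \<Rightarrow> bool" where
  "well_posed_discretization nb f D I S M vmax dt W \<longleftrightarrow>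
     (\<forall>i. \<forall>li\<in>tuples I (Suc (length (nb i))).
        \<exists>l'\<in>I. well_posed_transition nb f D I S M vmax dt W i li l')"

text \<open>
  Solutions in $D$ of $\dot\chi_i = f_i(\chi_i, \mathbf{x}_{j,G})$, $\chi_i(0) = x_{i,G}$, for the
  tuple of reference points \<open>z\<close> $= (x_{i,G}, \mathbf{x}_{j,G})$.
\<close>

definition reference_solution ::
  "('k \<Rightarrow> (real^'n) list \<Rightarrow> real^'n) \<Rightarrow> (real^'n) set \<Rightarrow> 'k \<Rightarrow> (real^'n) list
    \<Rightarrow> real set \<Rightarrow> (real \<Rightarrow> real^'n) \<Rightarrow> bool" where
  "reference_solution f D i z J chi \<longleftrightarrow>
     is_interval J \<and> 0 \<in> J \<and> J \<subseteq> {0..} \<and> chi 0 = hd z \<and>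
     (\<forall>t\<in>J. chi t \<in> D \<and> (chi has_vector_derivative f i (chi t # tl z)) (at t within J))"

definition reference_trajectory ::
  "('k \<Rightarrow> (real^'n) list \<Rightarrow> real^'n) \<Rightarrow> (real^'n) set \<Rightarrow> 'k \<Rightarrow> (real^'n) list
    \<Rightarrow> real set \<Rightarrow> (real \<Rightarrow> real^'n) \<Rightarrow> bool" where
  "reference_trajectory f D i z J chi \<longleftrightarrow>
     reference_solution f D i z J chi \<and>
     (\<forall>J' chi'. reference_solution f D i z J' chi' \<and> J \<subseteq> J' \<and> (\<forall>t\<in>J. chi' t = chi t) \<longrightarrow> J' = J)"

text \<open>
  The roots of $M L \delta^2 - (1-\lambda) v_{\max} \delta + d_{\max} = 0$, and the bound on
  $d_{\max}$ at which $\mu d_{\max} / (2 \lambda v_{\max})$ is such a root.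
\<close>

definition dt_low :: "real \<Rightarrow> real \<Rightarrow> real \<Rightarrow> real \<Rightarrow> real \<Rightarrow> real" where
  "dt_low lam vmax M L d =
     ((1 - lam) * vmax - sqrt ((1 - lam)\<^sup>2 * vmax\<^sup>2 - 4 * M * L * d)) / (2 * M * L)"

definition dt_high :: "real \<Rightarrow> real \<Rightarrow> real \<Rightarrow> real \<Rightarrow> real \<Rightarrow> real" where
  "dt_high lam vmax M L d =
     ((1 - lam) * vmax + sqrt ((1 - lam)\<^sup>2 * vmax\<^sup>2 - 4 * M * L * d)) / (2 * M * L)"

definition d_mu :: "real \<Rightarrow> real \<Rightarrow> real \<Rightarrow> real \<Rightarrow> real \<Rightarrow> real" where
  "d_mu lam mu vmax M L =
     2 * (lam * (1 - lam) * mu - 2 * lam\<^sup>2) * vmax\<^sup>2 / (mu\<^sup>2 * M * L)"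

definition condition_I ::
  "real \<Rightarrow> real \<Rightarrow> real \<Rightarrow> real \<Rightarrow> real \<Rightarrow> real \<Rightarrow> real \<Rightarrow> bool" where
  "condition_I lam mu vmax M L d dt \<longleftrightarrow>
     0 \<le> mu \<and> mu \<le> 2 * lam / (1 - lam) \<and>
     d \<in> {0<..(1 - lam)\<^sup>2 * vmax\<^sup>2 / (4 * M * L)} \<and>
     dt \<in> {dt_low lam vmax M L d..dt_high lam vmax M L d}"

definition condition_II ::
  "real \<Rightarrow> real \<Rightarrow> real \<Rightarrow> real \<Rightarrow> real \<Rightarrow> real \<Rightarrow> real \<Rightarrow> bool" where
  "condition_II lam mu vmax M L d dt \<longleftrightarrow>
     2 * lam / (1 - lam) < mu \<and> mu < 4 * lam / (1 - lam) \<and>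
     (d \<in> {0<..d_mu lam mu vmax M L} \<and>
      dt \<in> {mu / (2 * lam * vmax) * d..dt_high lam vmax M L d} \<or>
      d \<in> {d_mu lam mu vmax M L<..(1 - lam)\<^sup>2 * vmax\<^sup>2 / (4 * M * L)} \<and>
      dt \<in> {dt_low lam vmax M L d..dt_high lam vmax M L d})"

definition condition_III ::
  "real \<Rightarrow> real \<Rightarrow> real \<Rightarrow> real \<Rightarrow> real \<Rightarrow> real \<Rightarrow> real \<Rightarrow> bool" where
  "condition_III lam mu vmax M L d dt \<longleftrightarrow>
     4 * lam / (1 - lam) \<le> mu \<and>
     d \<in> {0<..d_mu lam mu vmax M L} \<and>
     dt \<in> {mu / (2 * lam * vmax) * d..dt_high lam vmax M L d}"

end

theory Submission
  imports Defs
begin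

text \<open>
  Agent \<open>i\<close> uses a feedback that cancels the coupling, so that it moves along
  $p(t) = \chi_i(t) + (1 - t/\delta t)(x_{i0} - x_{i,G}) + t w_i$ and reaches
  $\chi_i(\delta t) + \delta t\, w_i$, which ranges over the ball of radius $r$ as $w_i$ ranges over
  $W$. The required input is at most
  $L_2 M \delta t + 3 L_1 \sqrt{N_i} M \delta t + d_{\max}/\delta t + \lambda v_{\max}$, and each
  of the three cases implies that
  $M L\, \delta t^2 + d_{\max} \le (1-\lambda) v_{\max} \delta t$, i.e. that $\delta t$ lies
  between the roots of a quadratic; hence the input is admissible.

  The delicate point is that closed loop solutions do not leave $D^N$ before $\delta t$: the feedback
  laws of the other agents are only locally Lipschitz on $D$, so along a solution that approaches the
  boundary the input may fail to be piecewise continuous up to the exit time. The input is therefore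
  frozen shortly before that time. The resulting open loop flow stays in $D^N$ by the Invariance
  Assumption, and it shrinks distances at most by a factor independent of the freezing time; by
  invariance of domain its image contains a ball of fixed radius, hence the limit point.
\<close>

section \<open>Ordinary differential equations\<close>

text \<open>Two solutions with the same open loop input differ by a function whose derivative is a
  difference of drifts. The distortion of the open loop flow is thus governed by the Lipschitz
  constant of the drift alone, which is why the freezing time does not enter the radius of the image
  ball.

  (P2) bounds the inputs only near the initial cells, so a first exit argument must precede every
  use of that bound.

  The bound on the required input presupposes that agent \<open>i\<close> is on the curve
  \<open>p\<close>, which is what it should imply. The law in use is therefore saturated. Its
  distance from the required input is at most \<open>L2\<close> times the deviation from
  \<open>p\<close>; the deviation starts at 0, so Gronwall's inequality makes it vanish.

  The reference trajectory is no trajectory of the system, since its neighbors stand still. It is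
  nevertheless component \<open>i\<close> of a solution with admissible inputs, and so exists in
  \<open>D\<close> up to \<open>dt\<close>. Likewise, each point of the ball of radius
  \<open>r\<close> lies in \<open>D\<close> because it is the end point of an actual
  solution.\<close>

lemma gronwall_norm:
  fixes e :: "real \<Rightarrow> 'a::real_inner"
  assumes ab: "a \<le> b"
    and der: "\<And>t. t \<in> {a..b} \<Longrightarrow> (e has_vector_derivative e' t) (at t within {a..b})"
    and bnd: "\<And>t. t \<in> {a..b} \<Longrightarrow> norm (e' t) \<le> K * norm (e t)"
  shows "norm (e b) \<le> exp (K * (b - a)) * norm (e a)"
    and "norm (e a) \<le> exp (K * (b - a)) * norm (e b)"
proof -
  \<comment> \<open>\<open>\<sigma>\<close> selects the direction: for 1 the square of the norm
    times exp(2Kt) increases, for -1 the square times exp(-2Kt) decreases. Squares are used because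
    the norm is not differentiable where \<open>e\<close> vanishes.\<close>
  have mono: "\<sigma> * ((norm (e a))\<^sup>2 * exp (\<sigma> * 2 * K * a)) \<le> \<sigma> * ((norm (e b))\<^sup>2 * exp (\<sigma> * 2 * K * b))"
    if \<sigma>: "\<sigma> = 1 \<or> \<sigma> = -1" for \<sigma> :: real
  proof -
    define g where "g t = \<sigma> * ((e t \<bullet> e t) * exp (\<sigma> * 2 * K * t))" for t
    have ce: "continuous_on {a..b} e"
      by (auto simp: continuous_on_eq_continuous_within intro: has_vector_derivative_continuous[OF der])
    have "g a \<le> g b"
    proof (rule DERIV_nonneg_imp_increasing_open[OF ab])
      show "continuous_on {a..b} g"
        unfolding g_def by (intro continuous_intros ce)
    next
      fix t assume t: "a < t" "t < b"
      have d: "(e has_vector_derivative e' t) (at t)"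
        using der[of t] t by (metis at_within_Icc_at atLeastAtMost_iff less_imp_le)
      have "(g has_real_derivative \<sigma> * ((2 * (e t \<bullet> e' t)) * exp (\<sigma> * 2 * K * t)
          + (e t \<bullet> e t) * (exp (\<sigma> * 2 * K * t) * (\<sigma> * 2 * K)))) (at t)"
        unfolding g_def
        apply (rule DERIV_cmult)
        apply (rule DERIV_mult'[THEN DERIV_cong])
          apply (rule has_real_derivative_iff_has_vector_derivative[THEN iffD2])
          apply (rule bounded_bilinear.has_vector_derivative[OF bounded_bilinear_inner d d])
         apply (auto intro!: derivative_eq_intros simp: inner_commute algebra_simps)
        done
      moreover have "0 \<le> \<sigma> * ((2 * (e t \<bullet> e' t)) * exp (\<sigma> * 2 * K * t)
          + (e t \<bullet> e t) * (exp (\<sigma> * 2 * K * t) * (\<sigma> * 2 * K)))"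
      proof -
        have "\<bar>e t \<bullet> e' t\<bar> \<le> norm (e t) * norm (e' t)" by (rule Cauchy_Schwarz_ineq2)
        also have "\<dots> \<le> norm (e t) * (K * norm (e t))"
          using bnd[of t] t by (intro mult_left_mono) auto
        also have "\<dots> = K * (e t \<bullet> e t)" by (simp add: dot_square_norm power2_eq_square)
        finally have "\<bar>e t \<bullet> e' t\<bar> \<le> K * (e t \<bullet> e t)" .
        hence "0 \<le> 2 * (\<sigma> * (e t \<bullet> e' t) + K * (e t \<bullet> e t)) * exp (\<sigma> * 2 * K * t)"
          using \<sigma> by (intro mult_nonneg_nonneg) auto
        also have "\<dots> = \<sigma> * ((2 * (e t \<bullet> e' t)) * exp (\<sigma> * 2 * K * t)
          + (e t \<bullet> e t) * (exp (\<sigma> * 2 * K * t) * (\<sigma> * 2 * K)))"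
          using \<sigma> by (auto simp: algebra_simps)
        finally show ?thesis .
      qed
      ultimately show "\<exists>y. (g has_real_derivative y) (at t) \<and> 0 \<le> y" by blast
    qed
    thus ?thesis by (simp add: g_def dot_square_norm)
  qed
  have sq: "x \<le> exp (K * (b - a)) * y" if "x\<^sup>2 * exp (2 * K * a) \<le> y\<^sup>2 * exp (2 * K * b)" "0 \<le> y" for x y
  proof (rule power2_le_imp_le)
    have "x\<^sup>2 \<le> y\<^sup>2 * exp (2 * K * b) / exp (2 * K * a)"
      using that by (simp add: field_simps)
    also have "\<dots> = (exp (K * (b - a)) * y)\<^sup>2"
      by (simp add: power_mult_distrib exp_double[symmetric] right_diff_distrib exp_diff power_divide mult.assoc)
    finally show "x\<^sup>2 \<le> (exp (K * (b - a)) * y)\<^sup>2" .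
  qed (use that in auto)
  show "norm (e a) \<le> exp (K * (b - a)) * norm (e b)"
    using mono[of 1] by (intro sq) auto
  have "(norm (e b))\<^sup>2 * exp (2 * K * a) \<le> (norm (e a))\<^sup>2 * exp (2 * K * b)"
    using mono[of "-1"] by (simp add: exp_minus field_simps)
  thus "norm (e b) \<le> exp (K * (b - a)) * norm (e a)"
    by (intro sq) auto
qed

lemma speed_bound:
  fixes x :: "real \<Rightarrow> 'a::real_inner"
  assumes "a \<le> b" and c: "continuous_on {a..b} x"
    and der: "\<And>t. a < t \<Longrightarrow> t < b \<Longrightarrow> \<exists>v. (x has_vector_derivative v) (at t) \<and> norm v \<le> B"
  shows "norm (x b - x a) \<le> B * (b - a)"
proof (cases "a = b")
  case False
  hence ab: "a < b" using assms by simp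
  obtain x' where x': "\<And>t. a < t \<Longrightarrow> t < b \<Longrightarrow> (x has_vector_derivative x' t) (at t) \<and> norm (x' t) \<le> B"
    using der by metis
  have "\<exists>t\<in>{a<..<b}. norm (x b - x a) \<le> norm ((\<lambda>h. h *\<^sub>R x' t) (b - a))"
    using x' by (intro mvt_general[OF ab c]) (auto simp: has_vector_derivative_def)
  then obtain t where "t \<in> {a<..<b}" "norm (x b - x a) \<le> \<bar>b - a\<bar> * norm (x' t)" by auto
  thus ?thesis using x'[of t] ab
    by (smt (verit, ccfv_SIG) greaterThanLessThan_iff mult.commute mult_left_mono)
qed auto

text \<open>Fixed point of the Picard operator: \<open>B * (b - a) \<le> \<rho>\<close> keeps its
  values in the ball, and \<open>C * (b - a) \<le> 1/2\<close> makes it a contraction.\<close>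

lemma picard_lindelof_local:
  fixes V :: "real \<Rightarrow> 'a::euclidean_space \<Rightarrow> 'a"
  assumes ab: "a \<le> b" and \<rho>: "0 \<le> \<rho>" and C: "0 \<le> C"
    and cont: "continuous_on ({a..b} \<times> cball y0 \<rho>) (\<lambda>p. V (fst p) (snd p))"
    and lip: "\<And>t x y. t \<in> {a..b} \<Longrightarrow> x \<in> cball y0 \<rho> \<Longrightarrow> y \<in> cball y0 \<rho> \<Longrightarrow>
        dist (V t x) (V t y) \<le> C * dist x y"
    and bnd: "\<And>t x. t \<in> {a..b} \<Longrightarrow> x \<in> cball y0 \<rho> \<Longrightarrow> norm (V t x) \<le> B"
    and B: "B * (b - a) \<le> \<rho>" and Cab: "C * (b - a) \<le> 1/2"
  shows "\<exists>x. x a = y0 \<and>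
    (\<forall>t\<in>{a..b}. x t \<in> cball y0 \<rho> \<and> (x has_vector_derivative V t (x t)) (at t within {a..b}))"
proof -
  \<comment> \<open>Clamping the upper limit of integration gives functions on the whole line, so
    that the operator acts on the complete space of bounded continuous functions.\<close>
  define c where "c t = max a (min b t)" for t
  have c: "c t \<in> {a..b}" for t using ab by (auto simp: c_def)
  define S where "S = {g :: real \<Rightarrow>\<^sub>C 'a. \<forall>t. apply_bcontfun g t \<in> cball y0 \<rho>}"
  define P where "P g t = y0 + integral {a..c t} (\<lambda>s. V s (apply_bcontfun g s))" for g :: "real \<Rightarrow>\<^sub>C 'a" and t
  have B0: "0 \<le> B" using bnd[of a y0] ab \<rho> norm_ge_zero[of "V a y0"] by (auto simp del: norm_ge_zero)
  have Vc: "continuous_on {a..b} (\<lambda>s. V s (apply_bcontfun g s))" if "g \<in> S" for g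
  proof -
    have "continuous_on {a..b} (\<lambda>s. (s, apply_bcontfun g s))"
      by (intro continuous_on_Pair continuous_on_id continuous_on_apply_bcontfun)
    moreover have "(\<lambda>s. (s, apply_bcontfun g s)) ` {a..b} \<subseteq> {a..b} \<times> cball y0 \<rho>"
      using that by (auto simp: S_def)
    ultimately show ?thesis
      using continuous_on_compose2[OF cont] by fastforce
  qed
  have Vi: "(\<lambda>s. V s (apply_bcontfun g s)) integrable_on {a..c t}" if "g \<in> S" for g t
    using c[of t] by (intro integrable_continuous_interval continuous_on_subset[OF Vc[OF that]]) auto
  have Pb: "P g t \<in> cball y0 \<rho>" if "g \<in> S" for g t
  proof -
    have "norm (integral {a..c t} (\<lambda>s. V s (apply_bcontfun g s))) \<le> B * (c t - a)"
      using c[of t] that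
      by (intro integral_bound continuous_on_subset[OF Vc[OF that]] bnd) (auto simp: S_def)
    also have "\<dots> \<le> B * (b - a)" using c[of t] B0 by (intro mult_left_mono) auto
    finally show ?thesis using B by (simp add: P_def dist_norm)
  qed
  have Pc: "continuous_on UNIV (P g)" if "g \<in> S" for g
  proof -
    have "continuous_on {a..b} (\<lambda>t. integral {a..t} (\<lambda>s. V s (apply_bcontfun g s)))"
      by (intro indefinite_integral_continuous_1 integrable_continuous_interval Vc that)
    moreover have "continuous_on UNIV c" unfolding c_def by (intro continuous_intros)
    ultimately have "continuous_on UNIV (\<lambda>t. integral {a..c t} (\<lambda>s. V s (apply_bcontfun g s)))"
      by (rule continuous_on_compose2) (use c in auto)
    thus ?thesis unfolding P_def by (rule continuous_on_add[OF continuous_on_const])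
  qed
  have Pbc: "P g \<in> bcontfun" if "g \<in> S" for g
    using Pb[OF that] by (intro bcontfun_normI[OF Pc[OF that], of "norm y0 + \<rho>"])
      (smt (verit, del_insts) dist_norm mem_cball norm_minus_commute norm_triangle_sub)
  define Q where "Q g = Bcontfun (P g)" for g
  have Q: "apply_bcontfun (Q g) = P g" if "g \<in> S" for g
    unfolding Q_def using Pbc[OF that] by (simp add: Bcontfun_inverse)
  have "S = PiC UNIV (\<lambda>_. cball y0 \<rho>)"
    by (auto simp: S_def mem_PiC_iff Pi_iff)
  hence "closed S" by (simp add: closed_PiC)
  hence "complete S" by (simp add: complete_eq_closed)
  moreover have "S \<noteq> {}"
  proof -
    have "const_bcontfun y0 \<in> S" using \<rho> by (auto simp: S_def)
    thus ?thesis by auto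
  qed
  moreover have "Q ` S \<subseteq> S" using Pb Q by (auto simp: S_def)
  moreover have "dist (Q g) (Q h) \<le> 1/2 * dist g h" if gh: "g \<in> S \<and> h \<in> S" for g h
  proof (rule dist_bound)
    fix t
    have "dist (apply_bcontfun (Q g) t) (apply_bcontfun (Q h) t)
        = norm (integral {a..c t} (\<lambda>s. V s (apply_bcontfun g s)) - integral {a..c t} (\<lambda>s. V s (apply_bcontfun h s)))"
      using gh by (simp add: Q P_def dist_norm)
    also have "\<dots> = norm (integral {a..c t} (\<lambda>s. V s (apply_bcontfun g s) - V s (apply_bcontfun h s)))"
      using gh by (simp add: integral_diff Vi)
    also have "\<dots> \<le> (C * dist g h) * (c t - a)"
    proof (rule integral_bound)
      fix s assume s: "s \<in> {a..c t}"
      have "norm (V s (apply_bcontfun g s) - V s (apply_bcontfun h s)) \<le> C * dist (apply_bcontfun g s) (apply_bcontfun h s)"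
        using lip[of s "apply_bcontfun g s" "apply_bcontfun h s"] gh s c[of t] by (auto simp: S_def dist_norm)
      also have "\<dots> \<le> C * dist g h" by (intro mult_left_mono dist_bounded C)
      finally show "norm (V s (apply_bcontfun g s) - V s (apply_bcontfun h s)) \<le> C * dist g h" .
    next
      show "continuous_on {a..c t} (\<lambda>s. V s (apply_bcontfun g s) - V s (apply_bcontfun h s))"
        using gh c[of t] by (intro continuous_intros continuous_on_subset[OF Vc]) auto
    qed (use c[of t] in auto)
    also have "\<dots> = (C * (c t - a)) * dist g h" by simp
    also have "\<dots> \<le> 1/2 * dist g h"
    proof (rule mult_right_mono)
      have "C * (c t - a) \<le> C * (b - a)" using c[of t] C by (intro mult_left_mono) auto
      thus "C * (c t - a) \<le> 1/2" using Cab by simp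
    qed simp
    finally show "dist (apply_bcontfun (Q g) t) (apply_bcontfun (Q h) t) \<le> 1/2 * dist g h" .
  qed
  ultimately have "\<exists>!g. g \<in> S \<and> Q g = g"
    by (intro Banach_fix[where c = "1/2"]) auto
  then obtain g where g: "g \<in> S" "Q g = g" by blast
  define x where "x = apply_bcontfun g"
  have x: "x t = P g t" for t using Q[OF g(1)] g(2) by (simp add: x_def)
  show ?thesis
  proof (intro exI[of _ x] conjI ballI)
    show "x a = y0" using ab by (simp add: x P_def c_def)
  next
    fix t assume t: "t \<in> {a..b}"
    show "x t \<in> cball y0 \<rho>" using g by (simp add: x_def S_def)
    have "((\<lambda>t. integral {a..t} (\<lambda>s. V s (x s))) has_vector_derivative V t (x t)) (at t within {a..b})"
      using Vc[OF g(1)] t unfolding x_def by (intro integral_has_vector_derivative) auto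
    hence "((\<lambda>t. y0 + integral {a..t} (\<lambda>s. V s (x s))) has_vector_derivative V t (x t)) (at t within {a..b})"
      by (auto intro!: derivative_eq_intros)
    thus "(x has_vector_derivative V t (x t)) (at t within {a..b})"
    proof (rule has_vector_derivative_transform[OF t, rotated])
      fix s assume "s \<in> {a..b}"
      hence "c s = s" by (simp add: c_def)
      thus "x s = y0 + integral {a..s} (\<lambda>r. V r (x r))"
        using x[of s] by (simp add: P_def x_def)
    qed
  qed
qed

section \<open>Uniqueness and continuation of solutions\<close>

text \<open>Counterpart of \<open>locally_lipschitz_tuple\<close> for a single state variable. The
  sum of the distances replaces the Euclidean one, which changes only the constants.\<close>

definition locally_lipschitz_on ::
  "real set \<Rightarrow> 'a::metric_space set \<Rightarrow> (real \<Rightarrow> 'a \<Rightarrow> 'b::metric_space) \<Rightarrow> bool" where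
  "locally_lipschitz_on T U V \<longleftrightarrow>
     (\<forall>t\<in>T. \<forall>x\<in>U. \<exists>e>0. \<exists>C\<ge>0. \<forall>s\<in>T. \<forall>s'\<in>T. \<forall>y\<in>U. \<forall>y'\<in>U.
        dist s t < e \<longrightarrow> dist s' t < e \<longrightarrow> dist y x < e \<longrightarrow> dist y' x < e \<longrightarrow>
        dist (V s y) (V s' y') \<le> C * (dist s s' + dist y y'))"

lemma locally_lipschitz_on_continuous:
  assumes "locally_lipschitz_on T U V"
  shows "continuous_on (T \<times> U) (\<lambda>p. V (fst p) (snd p))"
  unfolding continuous_on_iff
proof (intro ballI allI impI)
  fix p and \<epsilon> :: real assume p: "p \<in> T \<times> U" and \<epsilon>: "0 < \<epsilon>"
  then have "fst p \<in> T" "snd p \<in> U" by auto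
  then obtain e C where e: "e > 0" and C: "C \<ge> 0" and
    L: "\<forall>s\<in>T. \<forall>s'\<in>T. \<forall>y\<in>U. \<forall>y'\<in>U.
        dist s (fst p) < e \<longrightarrow> dist s' (fst p) < e \<longrightarrow> dist y (snd p) < e \<longrightarrow> dist y' (snd p) < e \<longrightarrow>
        dist (V s y) (V s' y') \<le> C * (dist s s' + dist y y')"
    using assms unfolding locally_lipschitz_on_def by blast
  define d where "d = min e (\<epsilon> / (2 * (C + 1)))"
  have d: "d > 0" using e C \<epsilon> by (simp add: d_def)
  show "\<exists>d>0. \<forall>q\<in>T \<times> U. dist q p < d \<longrightarrow> dist (V (fst q) (snd q)) (V (fst p) (snd p)) < \<epsilon>"
  proof (intro exI[of _ d] conjI ballI impI d)
    fix q assume q: "q \<in> T \<times> U" "dist q p < d"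
    have 1: "dist (fst q) (fst p) < d" "dist (snd q) (snd p) < d"
      using q dist_fst_le[of q p] dist_snd_le[of q p] by linarith+
    have "dist (V (fst q) (snd q)) (V (fst p) (snd p)) \<le> C * (dist (fst q) (fst p) + dist (snd q) (snd p))"
      using 1 p q e by (intro L[rule_format]) (auto simp: d_def)
    also have "\<dots> \<le> C * (2 * d)" using 1 C by (intro mult_left_mono) auto
    also have "\<dots> < (C + 1) * (2 * d)" using d by simp
    also have "\<dots> \<le> (C + 1) * (2 * (\<epsilon> / (2 * (C + 1))))"
      using C by (intro mult_left_mono) (auto simp: d_def)
    also have "\<dots> = \<epsilon>" using C by (simp add: field_simps)
    finally show "dist (V (fst q) (snd q)) (V (fst p) (snd p)) < \<epsilon>" .
  qed
qed

lemma locally_lipschitz_on_compose_continuous: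
  assumes V: "locally_lipschitz_on T U V" and x: "continuous_on J x" and J: "J \<subseteq> T" "x ` J \<subseteq> U"
  shows "continuous_on J (\<lambda>t. V t (x t))"
proof -
  have "continuous_on J (\<lambda>t. (t, x t))" by (intro continuous_intros x)
  moreover have "(\<lambda>t. (t, x t)) ` J \<subseteq> T \<times> U" using J by auto
  ultimately have "continuous_on J ((\<lambda>p. V (fst p) (snd p)) \<circ> (\<lambda>t. (t, x t)))"
    by (intro continuous_on_compose continuous_on_subset[OF locally_lipschitz_on_continuous[OF V]])
  thus ?thesis by (simp add: o_def)
qed

text \<open>The derivative is relative to \<open>J\<close>: one-sided at end points that belong to
  \<open>J\<close> and vacuous on a one-point \<open>J\<close>. This covers \<open>{0..t}\<close>,
  \<open>{0..<\<tau>}\<close> and \<open>{0..}\<close> alike.\<close>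

definition ode_solution ::
  "(real \<Rightarrow> 'a::real_normed_vector \<Rightarrow> 'a) \<Rightarrow> 'a set \<Rightarrow> real set \<Rightarrow> (real \<Rightarrow> 'a) \<Rightarrow> bool" where
  "ode_solution V U J x \<longleftrightarrow>
     (\<forall>t\<in>J. x t \<in> U \<and> (x has_vector_derivative V t (x t)) (at t within J))"

lemma ode_solutionD:
  assumes "ode_solution V U J x" "t \<in> J"
  shows "x t \<in> U" "(x has_vector_derivative V t (x t)) (at t within J)"
  using assms by (auto simp: ode_solution_def)

lemma ode_solution_subset:
  "ode_solution V U J x \<Longrightarrow> J' \<subseteq> J \<Longrightarrow> ode_solution V U J' x"
  unfolding ode_solution_def by (meson has_vector_derivative_within_subset subsetD)

lemma ode_solution_continuous: "ode_solution V U J x \<Longrightarrow> continuous_on J x"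
  unfolding ode_solution_def continuous_on_eq_continuous_within
  by (blast intro: has_vector_derivative_continuous)

lemma ode_solution_transform:
  assumes "ode_solution V U J x" "\<And>t. t \<in> J \<Longrightarrow> y t = x t"
  shows "ode_solution V U J y"
  unfolding ode_solution_def
proof (intro ballI conjI)
  fix t assume t: "t \<in> J"
  show "y t \<in> U" using assms t by (simp add: ode_solution_def)
  have "(x has_vector_derivative V t (x t)) (at t within J)" using ode_solutionD(2)[OF assms(1) t] .
  hence "(x has_vector_derivative V t (y t)) (at t within J)" using assms(2)[OF t] by simp
  thus "(y has_vector_derivative V t (y t)) (at t within J)"
    by (rule has_vector_derivative_transform[OF t, rotated]) (simp add: assms(2))
qed

lemma ode_solution_singleton: "x t \<in> U \<Longrightarrow> ode_solution V U {t} x"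
  by (simp add: ode_solution_def has_vector_derivative_def has_derivative_within_singleton_iff
      bounded_linear_scaleR_left)

text \<open>The one-sided derivatives at \<open>s\<close> agree, since both are the value of
  \<open>V\<close> at the common state.\<close>

lemma ode_solution_glue:
  assumes x: "ode_solution V U {a..s} x" and y: "ode_solution V U {s..b} y"
    and eq: "x s = y s" and ab: "a \<le> s" "s \<le> b"
  shows "ode_solution V U {a..b} (\<lambda>t. if t \<in> {a..s} then x t else y t)"
  unfolding ode_solution_def
proof (intro ballI conjI)
  fix t assume t: "t \<in> {a..b}"
  let ?z = "\<lambda>t. if t \<in> {a..s} then x t else y t"
  show "?z t \<in> U" using t ode_solutionD(1)[OF x, of t] ode_solutionD(1)[OF y, of t] by auto
  have c: "closure {a..s} \<inter> closure {s..b} = {s}" using ab by auto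
  have "(?z has_vector_derivative (if t \<in> {a..s} then V t (x t) else V t (y t)))
      (at t within {a..b})"
  proof (rule has_vector_derivative_If_within_closures[where T = "{s..b}"])
    show "t \<in> {a..s} \<union> {s..b}" "{a..b} = {a..s} \<union> {s..b}" using t ab by auto
    show "(x has_vector_derivative V t (x t)) (at t within {a..s} \<union> closure {a..s} \<inter> closure {s..b})"
      if "t \<in> {a..s} \<union> closure {a..s} \<inter> closure {s..b}"
      using that ode_solutionD(2)[OF x, of t] ab unfolding c by (auto simp: insert_absorb)
    show "(y has_vector_derivative V t (y t)) (at t within {s..b} \<union> closure {a..s} \<inter> closure {s..b})"
      if "t \<in> {s..b} \<union> closure {a..s} \<inter> closure {s..b}"
      using that ode_solutionD(2)[OF y, of t] ab unfolding c by (auto simp: insert_absorb)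
    show "x t = y t" "V t (x t) = V t (y t)"
      if "t \<in> closure {a..s}" "t \<in> closure {s..b}"
      using that eq ab by (auto dest: antisym)
  qed
  thus "(?z has_vector_derivative V t (?z t)) (at t within {a..b})"
    by (simp add: if_distrib cong: if_cong)
qed

text \<open>A Lipschitz constant is available only near a point, so Gronwall's inequality is applied
  right after the infimum \<open>s\<close> of the times of disagreement.\<close>

lemma ode_solution_unique:
  fixes x y :: "real \<Rightarrow> 'a::real_inner"
  assumes V: "locally_lipschitz_on T U V" and T: "{a..b} \<subseteq> T"
    and x: "ode_solution V U {a..b} x" and y: "ode_solution V U {a..b} y"
    and init: "x a = y a" and t: "t \<in> {a..b}"
  shows "x t = y t"
proof (rule ccontr)
  assume "x t \<noteq> y t"
  define E where "E = {t\<in>{a..b}. x t \<noteq> y t}"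
  define s where "s = Inf E"
  have E: "E \<noteq> {}" "bdd_below E" using \<open>x t \<noteq> y t\<close> t by (auto simp: E_def)
  have lb: "s \<le> t" if "t \<in> E" for t unfolding s_def by (rule cInf_lower[OF that E(2)])
  have s: "s \<in> {a..b}"
    using lb[of t] \<open>x t \<noteq> y t\<close> t cInf_greatest[OF E(1), of a] by (auto simp: E_def s_def)
  have cx: "continuous_on {a..b} x" and cy: "continuous_on {a..b} y"
    using ode_solution_continuous x y by auto
  \<comment> \<open>Otherwise continuity would produce a disagreement before
    \<open>s\<close>.\<close>
  have eq: "x s = y s"
  proof (rule ccontr)
    assume ne: "x s \<noteq> y s"
    have "continuous_on {a..b} (\<lambda>t. dist (x t) (y t))" by (intro continuous_intros cx cy)
    then obtain d where d: "d > 0"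
      "\<And>t. t \<in> {a..b} \<Longrightarrow> dist t s < d \<Longrightarrow> dist (dist (x t) (y t)) (dist (x s) (y s)) < dist (x s) (y s)"
      using s ne unfolding continuous_on_iff by (metis zero_less_dist_iff)
    have "s > a" using ne init s by (cases "s = a") auto
    define r where "r = max a (s - d/2)"
    have r: "r \<in> {a..b}" "dist r s < d" "r < s" using \<open>s > a\<close> s d(1) by (auto simp: r_def dist_real_def)
    have "x r \<noteq> y r" using d(2)[OF r(1,2)] by auto
    thus False using lb[of r] r by (auto simp: E_def)
  qed
  have sT: "s \<in> T" and xU: "x s \<in> U" using s T ode_solutionD(1)[OF x s] by auto
  obtain e C where e: "e > 0" "C \<ge> 0" and
    L: "\<forall>r\<in>T. \<forall>r'\<in>T. \<forall>z\<in>U. \<forall>z'\<in>U.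
        dist r s < e \<longrightarrow> dist r' s < e \<longrightarrow> dist z (x s) < e \<longrightarrow> dist z' (x s) < e \<longrightarrow>
        dist (V r z) (V r' z') \<le> C * (dist r r' + dist z z')"
    using V sT xU unfolding locally_lipschitz_on_def by blast
  obtain d where d: "d > 0" "\<And>t. t \<in> {a..b} \<Longrightarrow> dist t s < d \<Longrightarrow> dist (x t) (x s) < e"
    using cx s e unfolding continuous_on_iff by metis
  obtain d' where d': "d' > 0" "\<And>t. t \<in> {a..b} \<Longrightarrow> dist t s < d' \<Longrightarrow> dist (y t) (y s) < e"
    using cy s e unfolding continuous_on_iff by metis
  \<comment> \<open>A time of disagreement so close to \<open>s\<close> that both solutions stay in
    the Lipschitz neighborhood of the common state up to \<open>r\<close>.\<close>
  obtain r where r: "r \<in> E" "r < s + min e (min d d')"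
    using cInf_lessD[OF E(1), of "s + min e (min d d')"] d d' e by (auto simp: s_def)
  have sub: "{s..r} \<subseteq> {a..b}" using s r by (auto simp: E_def)
  have "norm (x r - y r) \<le> exp (C * (r - s)) * norm (x s - y s)"
  proof (rule gronwall_norm(1)[where e = "\<lambda>t. x t - y t" and e' = "\<lambda>t. V t (x t) - V t (y t)"])
    show "s \<le> r" using lb r by simp
  next
    fix t assume t: "t \<in> {s..r}"
    show "((\<lambda>t. x t - y t) has_vector_derivative V t (x t) - V t (y t)) (at t within {s..r})"
      using ode_solutionD(2)[OF ode_solution_subset[OF x sub] t] ode_solutionD(2)[OF ode_solution_subset[OF y sub] t]
      by (rule has_vector_derivative_diff)
    have ts: "dist t s < e" "dist t s < d" "dist t s < d'" using t r by (auto simp: dist_real_def)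
    have tab: "t \<in> {a..b}" using t sub by auto
    have "dist (V t (x t)) (V t (y t)) \<le> C * (dist t t + dist (x t) (y t))"
      using tab T ts d(2)[OF tab] d'(2)[OF tab] eq
      by (intro L[rule_format] ode_solutionD(1)[OF x] ode_solutionD(1)[OF y]) auto
    thus "norm (V t (x t) - V t (y t)) \<le> C * norm (x t - y t)" by (simp add: dist_norm)
  qed
  thus False using eq r by (simp add: E_def)
qed

text \<open>The union of all solution intervals carries a solution, because any two solutions agree
  where both are defined.\<close>

lemma ode_solution_greatest:
  fixes x0 :: "'a::real_inner"
  assumes V: "locally_lipschitz_on T U V" and T: "is_interval T" "0 \<in> T" "T \<subseteq> {0..}" and x0: "x0 \<in> U"
  defines "sol \<equiv> \<lambda>J x. is_interval J \<and> 0 \<in> J \<and> J \<subseteq> T \<and> x 0 = x0 \<and> ode_solution V U J x"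
  shows "\<exists>J x. sol J x \<and> (\<forall>J' y. sol J' y \<longrightarrow> J' \<subseteq> J \<and> (\<forall>t\<in>J'. y t = x t))"
proof -
  have seg: "{0..t} \<subseteq> J" if "sol J y" "t \<in> J" for J y t
    using that by (auto simp: sol_def intro: mem_is_interval_1_I[of J 0 t])
  have uniq: "y t = y' t" if "sol J y" "sol J' y'" "t \<in> J" "t \<in> J'" for J y J' y' t
  proof (rule ode_solution_unique[OF V, of 0 t])
    show "{0..t} \<subseteq> T" "ode_solution V U {0..t} y" "ode_solution V U {0..t} y'" "y 0 = y' 0"
      using seg[OF that(1,3)] seg[OF that(2,4)] that by (auto simp: sol_def intro: ode_solution_subset)
    show "t \<in> {0..t}" using that T(3) by (auto simp: sol_def)
  qed
  define JJ where "JJ = \<Union>{J. \<exists>y. sol J y}"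
  define x where "x t = (SOME v. \<exists>J y. sol J y \<and> t \<in> J \<and> v = y t)" for t
  have x: "x t = y t" if "sol J y" "t \<in> J" for J y t
    unfolding x_def
  proof (rule some_equality)
    show "\<exists>J' y'. sol J' y' \<and> t \<in> J' \<and> y t = y' t" using that by blast
  qed (use uniq that in blast)
  have sub: "J \<subseteq> JJ" if "sol J y" for J y using that by (auto simp: JJ_def)
  have "sol {0} (\<lambda>_. x0)" using T x0 by (auto simp: sol_def is_interval_1 intro: ode_solution_singleton)
  hence 0: "0 \<in> JJ" "x 0 = x0" using sub x by auto
  have JT: "JJ \<subseteq> T" by (auto simp: JJ_def sol_def)
  have segJJ: "{0..t} \<subseteq> JJ" if "t \<in> JJ" for t using that seg by (fastforce simp: JJ_def)
  have "ode_solution V U JJ x"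
    unfolding ode_solution_def
  proof
    fix t assume t: "t \<in> JJ"
    have t0: "0 \<le> t" using t JT T by auto
    \<comment> \<open>If \<open>t\<close> is not the last time, \<open>t'\<close> lies beyond it, so
      that a single solution on \<open>{0..t'}\<close> determines the derivative at \<open>t\<close>
      relative to \<open>JJ\<close>; otherwise \<open>{0..t'}\<close> is \<open>JJ\<close>
      itself.\<close>
    obtain t' where t': "t' \<in> JJ" "t \<le> t'" "t < t' \<or> (\<forall>s\<in>JJ. s \<le> t)"
      using t by (metis less_eq_real_def not_le_imp_less order_refl)
    obtain J y where J: "sol J y" "t' \<in> J" using t'(1) by (auto simp: JJ_def)
    have s: "{0..t'} \<subseteq> J" by (rule seg[OF J])
    have "ode_solution V U {0..t'} x"
      by (rule ode_solution_transform[OF ode_solution_subset[of _ _ J y]]) (use J s x in \<open>auto simp: sol_def\<close>)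
    hence *: "x t \<in> U \<and> (x has_vector_derivative V t (x t)) (at t within {0..t'})"
      using t0 t' by (auto simp: ode_solution_def)
    have "at t within {0..t'} = at t within JJ"
    proof (cases "t < t'")
      case True
      show ?thesis
        by (rule at_within_nhd[of t "{..<t'}"]) (use True segJJ[OF t'(1)] JT T in auto)
    next
      case False
      hence "{0..t'} = JJ" using t' segJJ[OF t'(1)] JT T by force
      thus ?thesis by simp
    qed
    thus "x t \<in> U \<and> (x has_vector_derivative V t (x t)) (at t within JJ)" using * by simp
  qed
  moreover have "is_interval JJ"
    using segJJ JT T unfolding is_interval_1 by (metis atLeastAtMost_iff atLeast_iff order_trans subsetD)
  ultimately have "sol JJ x" using 0 JT by (simp add: sol_def)
  thus ?thesis using sub x by metis
qed

text \<open>Hypothesis \<open>lim\<close> excludes blow-up and exit from \<open>U\<close>. The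
  greatest solution comes arbitrarily close to some \<open>b\<close> in \<open>U\<close> near its
  end time; a local solution started there has a length that is uniform near \<open>b\<close>, hence
  overshoots the end time unless that is \<open>\<delta>\<close>.\<close>

lemma ode_solution_global:
  fixes x0 :: "'a::euclidean_space"
  assumes V: "locally_lipschitz_on {0..\<delta>} U V" and U: "open U" and \<delta>: "0 \<le> \<delta>" and x0: "x0 \<in> U"
    and lim: "\<And>\<tau> x. 0 < \<tau> \<Longrightarrow> \<tau> \<le> \<delta> \<Longrightarrow> x 0 = x0 \<Longrightarrow> ode_solution V U {0..<\<tau>} x \<Longrightarrow>
        \<exists>b\<in>U. (x \<longlongrightarrow> b) (at_left \<tau>)"
  shows "\<exists>x. x 0 = x0 \<and> ode_solution V U {0..\<delta>} x"
proof -
  have T: "0 \<in> {0..\<delta>}" "{0..\<delta>} \<subseteq> {0..}" using \<delta> by auto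
  from ode_solution_greatest[OF V is_interval_cc T x0] obtain J x where
    "is_interval J \<and> 0 \<in> J \<and> J \<subseteq> {0..\<delta>} \<and> x 0 = x0 \<and> ode_solution V U J x"
    and max': "\<forall>J' y. is_interval J' \<and> 0 \<in> J' \<and> J' \<subseteq> {0..\<delta>} \<and> y 0 = x0 \<and> ode_solution V U J' y \<longrightarrow>
        J' \<subseteq> J \<and> (\<forall>t\<in>J'. y t = x t)" by (elim exE conjE) (rule that, simp_all)
  hence J: "is_interval J" "0 \<in> J" "J \<subseteq> {0..\<delta>}" "x 0 = x0" "ode_solution V U J x" by simp_all
  have max: "J' \<subseteq> J" if "is_interval J'" "0 \<in> J'" "J' \<subseteq> {0..\<delta>}" "y 0 = x0" "ode_solution V U J' y" for J' y
    using max' that by simp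
  have bdd: "bdd_above J" using J(3) by (meson bdd_above.I2 bdd_above_Icc bdd_above_mono)
  define \<tau> where "\<tau> = Sup J"
  have ub: "t \<le> \<tau>" if "t \<in> J" for t unfolding \<tau>_def using that bdd by (rule cSup_upper)
  have \<tau>: "0 \<le> \<tau>" "\<tau> \<le> \<delta>"
    using ub[OF J(2)] cSup_least[of J \<delta>] J(2,3) by (force simp: \<tau>_def)+
  have below: "t \<in> J" if t: "0 \<le> t" "t < \<tau>" for t
  proof -
    obtain t' where "t' \<in> J" "t < t'" using less_cSupD[of J t] t J(2) by (auto simp: \<tau>_def)
    thus ?thesis using mem_is_interval_1_I[OF J(1,2), of t' t] t by auto
  qed
  \<comment> \<open>This form of approach serves both when the end time is attained and when it is
    not.\<close>
  have "\<exists>b\<in>U. \<forall>\<epsilon>>0. \<exists>s\<in>J. \<tau> - \<epsilon> < s \<and> dist (x s) b < \<epsilon>"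
  proof (cases "\<tau> \<in> J")
    case True
    thus ?thesis using ode_solutionD(1)[OF J(5) True]
      by (intro bexI[of _ "x \<tau>"] allI impI bexI[of _ \<tau>]) auto
  next
    case False
    hence \<tau>0: "0 < \<tau>" using J(2) \<tau>(1) by (cases "\<tau> = 0") auto
    have "ode_solution V U {0..<\<tau>} x" using below by (intro ode_solution_subset[OF J(5)]) auto
    then obtain b where b: "b \<in> U" "(x \<longlongrightarrow> b) (at_left \<tau>)" using lim[of \<tau> x] \<tau>0 \<tau>(2) J(4) by auto
    have "\<exists>s\<in>J. \<tau> - \<epsilon> < s \<and> dist (x s) b < \<epsilon>" if "\<epsilon> > 0" for \<epsilon>
    proof -
      have "eventually (\<lambda>s. dist (x s) b < \<epsilon>) (at_left \<tau>)" using tendstoD[OF b(2) that] .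
      moreover have "eventually (\<lambda>s. s \<in> {max 0 (\<tau> - \<epsilon>)<..<\<tau>}) (at_left \<tau>)"
        using that \<tau>0 by (intro eventually_at_left_real) auto
      ultimately have "eventually (\<lambda>s. s \<in> {max 0 (\<tau> - \<epsilon>)<..<\<tau>} \<and> dist (x s) b < \<epsilon>) (at_left \<tau>)"
        by eventually_elim auto
      then obtain s where "s \<in> {max 0 (\<tau> - \<epsilon>)<..<\<tau>}" "dist (x s) b < \<epsilon>"
        using eventually_happens[of _ "at_left \<tau>"] trivial_limit_at_left_real by blast
      thus ?thesis using below[of s] by (intro bexI[of _ s]) auto
    qed
    thus ?thesis using b(1) by blast
  qed
  then obtain b where b: "b \<in> U" "\<And>\<epsilon>. \<epsilon> > 0 \<Longrightarrow> \<exists>s\<in>J. \<tau> - \<epsilon> < s \<and> dist (x s) b < \<epsilon>" by blast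
  have "\<tau> \<in> {0..\<delta>}" using \<tau> by simp
  then obtain e C where e: "e > 0" and C: "C \<ge> 0" and
    L: "\<forall>s\<in>{0..\<delta>}. \<forall>s'\<in>{0..\<delta>}. \<forall>y\<in>U. \<forall>y'\<in>U.
        dist s \<tau> < e \<longrightarrow> dist s' \<tau> < e \<longrightarrow> dist y b < e \<longrightarrow> dist y' b < e \<longrightarrow>
        dist (V s y) (V s' y') \<le> C * (dist s s' + dist y y')"
    using V b(1) unfolding locally_lipschitz_on_def by blast
  obtain e1 where e1: "e1 > 0" "ball b e1 \<subseteq> U" using U b(1) openE by blast
  \<comment> \<open>The restart takes place at distance less than \<open>\<rho>\<close> from
    \<open>b\<close>, so its ball of radius \<open>\<rho>\<close> stays within
    \<open>2 * \<rho>\<close> of \<open>b\<close>. \<open>B\<close> bounds \<open>V\<close> there.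
    The restart time is after \<open>\<tau> - h\<close> and the new end time at most
    \<open>\<tau> + h\<close>, whence the factor 2 in the two bounds on \<open>h\<close>.\<close>
  define \<rho> where "\<rho> = min e e1 / 2"
  have \<rho>: "\<rho> > 0" "2 * \<rho> \<le> e" "2 * \<rho> \<le> e1" using e e1 by (auto simp: \<rho>_def)
  define B where "B = norm (V \<tau> b) + C * (2 * e)"
  have B: "B \<ge> 0" using C e by (simp add: B_def)
  define h where "h = min (e / 2) (min (\<rho> / (2 * (B + 1))) (1 / (4 * (C + 1))))"
  have h: "h > 0" "h < e" using e \<rho> B C by (auto simp: h_def)
  have hB: "B * (2 * h) \<le> \<rho>"
  proof -
    have "B * (2 * h) \<le> (B + 1) * (2 * h)" using h by simp
    also have "\<dots> \<le> (B + 1) * (2 * (\<rho> / (2 * (B + 1))))"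
      using B by (intro mult_left_mono) (auto simp: h_def)
    also have "\<dots> = \<rho>" using B by (simp add: field_simps)
    finally show ?thesis .
  qed
  have hC: "C * (2 * h) \<le> 1/2"
  proof -
    have "C * (2 * h) \<le> (C + 1) * (2 * h)" using h by simp
    also have "\<dots> \<le> (C + 1) * (2 * (1 / (4 * (C + 1))))"
      using C by (intro mult_left_mono) (auto simp: h_def)
    also have "\<dots> = 1/2" using C by (simp add: field_simps)
    finally show ?thesis .
  qed
  obtain s where s: "s \<in> J" "\<tau> - min \<rho> h < s" "dist (x s) b < min \<rho> h"
    using b(2)[of "min \<rho> h"] \<rho> h by auto
  have s0: "0 \<le> s" "s \<le> \<tau>" using s(1) J(3) ub by auto
  define t1 where "t1 = min \<delta> (\<tau> + h)"
  have t1: "s \<le> t1" "t1 - s \<le> 2 * h" "t1 \<le> \<delta>" using s s0 \<tau> h by (auto simp: t1_def)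
  have near: "y \<in> U \<and> dist y b < e" if "y \<in> cball (x s) \<rho>" for y
  proof -
    have "dist y b < 2 * \<rho>"
      using that s(3) dist_triangle[of y b "x s"] by (auto simp: dist_commute)
    thus ?thesis using \<rho> e1 by (auto simp: dist_commute subset_iff)
  qed
  have neart: "t \<in> {0..\<delta>} \<and> dist t \<tau> < e" if "t \<in> {s..t1}" for t
    using that s s0 h t1 by (auto simp: dist_real_def t1_def)
  have "\<exists>y. y s = x s \<and> (\<forall>t\<in>{s..t1}. y t \<in> cball (x s) \<rho> \<and>
      (y has_vector_derivative V t (y t)) (at t within {s..t1}))"
  proof (rule picard_lindelof_local)
    show "continuous_on ({s..t1} \<times> cball (x s) \<rho>) (\<lambda>p. V (fst p) (snd p))"
      by (rule continuous_on_subset[OF locally_lipschitz_on_continuous[OF V]]) (use near neart in blast)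
    show "dist (V t y) (V t z) \<le> C * dist y z"
      if "t \<in> {s..t1}" "y \<in> cball (x s) \<rho>" "z \<in> cball (x s) \<rho>" for t y z
      using L[rule_format, of t t y z] near neart that by auto
    show "norm (V t y) \<le> B" if "t \<in> {s..t1}" "y \<in> cball (x s) \<rho>" for t y
    proof -
      have "dist (V t y) (V \<tau> b) \<le> C * (dist t \<tau> + dist y b)"
        using L[rule_format, of t \<tau> y b] near neart that b(1) e \<tau> by auto
      also have "\<dots> \<le> C * (2 * e)"
        using near[OF that(2)] neart[OF that(1)] C by (intro mult_left_mono) auto
      finally show ?thesis
        using norm_triangle_ineq2[of "V t y" "V \<tau> b"] unfolding B_def dist_norm by linarith
    qed
    show "B * (t1 - s) \<le> \<rho>" using hB mult_left_mono[OF t1(2) B] by linarith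
    show "C * (t1 - s) \<le> 1/2" using hC mult_left_mono[OF t1(2) C] by linarith
  qed (use t1 \<rho> C in auto)
  then obtain y where y: "y s = x s" "\<And>t. t \<in> {s..t1} \<Longrightarrow> y t \<in> cball (x s) \<rho>"
    "\<And>t. t \<in> {s..t1} \<Longrightarrow> (y has_vector_derivative V t (y t)) (at t within {s..t1})" by blast
  have "ode_solution V U {s..t1} y"
    using y near unfolding ode_solution_def by blast
  moreover have "ode_solution V U {0..s} x"
    by (intro ode_solution_subset[OF J(5)]) (auto intro: mem_is_interval_1_I[OF J(1,2) s(1)])
  ultimately have "ode_solution V U {0..t1} (\<lambda>t. if t \<in> {0..s} then x t else y t)"
    using y(1) s0 t1 by (intro ode_solution_glue) auto
  hence "{0..t1} \<subseteq> J"
    using s0 t1 J(4) by (intro max[of "{0..t1}" "\<lambda>t. if t \<in> {0..s} then x t else y t"])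
      (auto simp: is_interval_cc)
  hence "t1 \<in> J" using s0 t1 by auto
  \<comment> \<open>Without the cap by \<open>\<delta>\<close>, \<open>t1\<close> would exceed the
    supremum of \<open>J\<close>.\<close>
  hence "t1 = \<delta>" using ub[of t1] h \<tau> by (auto simp: t1_def)
  hence "{0..\<delta>} \<subseteq> J" using \<open>{0..t1} \<subseteq> J\<close> by simp
  thus ?thesis using ode_solution_subset[OF J(5)] J(4) by blast
qed

section \<open>Expanding maps and a priori speed bounds\<close>

text \<open>The image of the open ball is open by invariance of domain, that of the closed ball is
  compact. Boundary points are mapped to distance at least \<open>c * \<rho>\<close> from the
  center's image, so inside the target ball both images coincide and form a clopen subset of a
  connected set.\<close>

lemma ball_subset_image_expanding:
  fixes \<Phi> :: "'a::euclidean_space \<Rightarrow> 'a"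
  assumes cont: "continuous_on (cball x \<rho>) \<Phi>" and c: "0 < c" and \<rho>: "0 < \<rho>"
    and exp: "\<And>y z. y \<in> cball x \<rho> \<Longrightarrow> z \<in> cball x \<rho> \<Longrightarrow> c * dist y z \<le> dist (\<Phi> y) (\<Phi> z)"
  shows "ball (\<Phi> x) (c * \<rho>) \<subseteq> \<Phi> ` cball x \<rho>"
proof -
  let ?O = "ball (\<Phi> x) (c * \<rho>)"
  have inj: "inj_on \<Phi> (ball x \<rho>)"
    using exp c by (intro inj_onI) (metis ball_subset_cball dist_le_zero_iff dist_self mult_le_0_iff not_less subsetD)
  have op: "open (\<Phi> ` ball x \<rho>)"
    by (rule invariance_of_domain[OF continuous_on_subset[OF cont] _ inj]) auto
  have cl: "closed (\<Phi> ` cball x \<rho>)"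
    by (intro compact_imp_closed compact_continuous_image cont) auto
  have eq: "?O \<inter> \<Phi> ` ball x \<rho> = ?O \<inter> \<Phi> ` cball x \<rho>"
  proof (intro equalityI subsetI)
    fix v assume v: "v \<in> ?O \<inter> \<Phi> ` cball x \<rho>"
    then obtain y where y: "y \<in> cball x \<rho>" "v = \<Phi> y" by auto
    have "c * dist x y < c * \<rho>" using exp[of x y] y v \<rho> by auto
    hence "y \<in> ball x \<rho>" using c by simp
    thus "v \<in> ?O \<inter> \<Phi> ` ball x \<rho>" using v y by auto
  qed auto
  have "openin (top_of_set ?O) (?O \<inter> \<Phi> ` ball x \<rho>)" using op by (rule openin_open_Int)
  moreover have "closedin (top_of_set ?O) (?O \<inter> \<Phi> ` ball x \<rho>)"
    unfolding eq using cl by (rule closedin_closed_Int)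
  ultimately have "?O \<inter> \<Phi> ` ball x \<rho> = {} \<or> ?O \<inter> \<Phi> ` ball x \<rho> = ?O"
    using connected_clopen[of ?O] connected_ball by blast
  moreover have "\<Phi> x \<in> ?O \<inter> \<Phi> ` ball x \<rho>" using c \<rho> by auto
  ultimately show ?thesis using eq by blast
qed

text \<open>A first exit argument: the speed bound is assumed only while every component is within
  \<open>B * \<delta>\<close> of its start, and at speed \<open>B\<close> that distance cannot be
  reached before time \<open>\<delta>\<close>. This is the situation created by (P2).\<close>

lemma componentwise_speed_bound:
  fixes x :: "real \<Rightarrow> 'a::real_inner^'k"
  assumes t1: "0 \<le> t1" "t1 \<le> \<delta>" and B: "0 < B"
    and der: "\<And>t m. t \<in> {0..t1} \<Longrightarrow> ((\<lambda>s. x s $ m) has_vector_derivative V t m) (at t within {0..t1})"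
    and bnd: "\<And>t m. t \<in> {0..t1} \<Longrightarrow> (\<And>k. norm (x t $ k - x 0 $ k) \<le> B * \<delta>) \<Longrightarrow> norm (V t m) \<le> B"
  shows "norm (x t1 $ m - x 0 $ m) \<le> B * t1"
proof -
  have c: "continuous_on {0..t1} (\<lambda>s. x s $ k)" for k
    by (auto simp: continuous_on_eq_continuous_within intro: has_vector_derivative_continuous[OF der])
  have der': "((\<lambda>s. x s $ k) has_vector_derivative V t k) (at t)" if "0 < t" "t < t1" for t k
    using der[of t k] that by (simp add: at_within_Icc_at)
  have small: "norm (x s $ k - x 0 $ k) < B * \<delta>" if s: "s \<in> {0..<t1}" for s k
  proof (rule ccontr)
    assume big: "\<not> norm (x s $ k - x 0 $ k) < B * \<delta>"
    \<comment> \<open>The union over all components is needed because the bound for one of them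
      presupposes that all are still close.\<close>
    define E where "E = (\<Union>k. {s\<in>{0..t1}. B * \<delta> \<le> norm (x s $ k - x 0 $ k)})"
    have "closed E" unfolding E_def
      by (intro closed_UN ballI continuous_on_closed_Collect_le continuous_intros c) auto
    moreover have "bounded E" by (rule bounded_subset[of "{0..t1}"]) (auto simp: E_def)
    moreover have "s \<in> E" using big s by (auto simp: E_def intro!: exI[of _ k])
    ultimately obtain r where r: "r \<in> E" "\<And>q. q \<in> E \<Longrightarrow> r \<le> q"
      using compact_attains_inf[of E] compact_eq_bounded_closed by blast
    then obtain j where j: "r \<in> {0..t1}" "B * \<delta> \<le> norm (x r $ j - x 0 $ j)" by (auto simp: E_def)
    have rs: "r \<le> s" using r(2)[OF \<open>s \<in> E\<close>] .
    have "norm (x r $ j - x 0 $ j) \<le> B * (r - 0)"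
    proof (rule speed_bound)
      show "continuous_on {0..r} (\<lambda>s. x s $ j)" using c j by (rule_tac continuous_on_subset) auto
      fix t assume t: "0 < t" "t < r"
      have "norm (x t $ k - x 0 $ k) \<le> B * \<delta>" for k
      proof (rule ccontr)
        assume "\<not> norm (x t $ k - x 0 $ k) \<le> B * \<delta>"
        hence "t \<in> E" using t j by (auto simp: E_def intro!: exI[of _ k])
        thus False using r(2)[of t] t by simp
      qed
      hence "norm (V t j) \<le> B" using t j by (intro bnd) auto
      thus "\<exists>v. ((\<lambda>s. x s $ j) has_vector_derivative v) (at t) \<and> norm v \<le> B"
        using der'[of t j] t j by auto
    qed (use j in auto)
    moreover have "B * r < B * \<delta>" using rs s t1 B by auto
    ultimately show False using j by simp
  qed
  have "norm (x t1 $ m - x 0 $ m) \<le> B * (t1 - 0)"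
  proof (rule speed_bound[OF t1(1) c])
    fix t assume t: "0 < t" "t < t1"
    have "norm (V t m) \<le> B" using t small[of t] by (intro bnd) (auto intro: less_imp_le)
    thus "\<exists>v. ((\<lambda>s. x s $ m) has_vector_derivative v) (at t) \<and> norm v \<le> B"
      using der'[of t m] t by auto
  qed
  thus ?thesis by simp
qed

lemma has_vector_derivative_cart:
  fixes x :: "real \<Rightarrow> 'a::real_normed_vector^'k"
  shows "(x has_vector_derivative v) (at t within J) \<longleftrightarrow>
    (\<forall>i. ((\<lambda>s. x s $ i) has_vector_derivative v $ i) (at t within J))"
proof
  assume "(x has_vector_derivative v) (at t within J)"
  thus "\<forall>i. ((\<lambda>s. x s $ i) has_vector_derivative v $ i) (at t within J)"
    using bounded_linear.has_vector_derivative[OF bounded_linear_vec_nth] by blast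
next
  assume *: "\<forall>i. ((\<lambda>s. x s $ i) has_vector_derivative v $ i) (at t within J)"
  show "(x has_vector_derivative v) (at t within J)"
    unfolding has_vector_derivative_def has_derivative_within
  proof (intro conjI bounded_linear_scaleR_left vec_tendstoI)
    fix i
    show "((\<lambda>y. ((1 / norm (y - t)) *\<^sub>R (x y - (x t + (y - t) *\<^sub>R v))) $ i) \<longlongrightarrow> 0 $ i) (at t within J)"
      using *[rule_format, of i] unfolding has_vector_derivative_def has_derivative_within by simp
  qed
qed

section \<open>The multi-agent system\<close>

lemma tuple_dist_nonneg [simp]: "0 \<le> tuple_dist xs ys"
  by (auto simp: tuple_dist_def intro!: sum_nonneg)

lemma tuple_dist_le:
  assumes "\<And>m. m < length xs \<Longrightarrow> dist (xs ! m) (ys ! m) \<le> c" "0 \<le> c"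
  shows "tuple_dist xs ys \<le> sqrt (real (length xs)) * c"
proof -
  have "(\<Sum>m<length xs. (dist (xs ! m) (ys ! m))\<^sup>2) \<le> (\<Sum>m<length xs. c\<^sup>2)"
    using assms by (intro sum_mono power_mono) auto
  hence "tuple_dist xs ys \<le> sqrt (real (length xs) * c\<^sup>2)"
    unfolding tuple_dist_def by (intro real_sqrt_le_mono) simp
  thus ?thesis using assms(2) by (simp add: real_sqrt_mult)
qed

lemma tuple_dist_Cons_sq:
  "(tuple_dist (x # xs) (y # ys))\<^sup>2 = (dist x y)\<^sup>2 + (tuple_dist xs ys)\<^sup>2"
  unfolding tuple_dist_def
  by (simp add: sum_nonneg sum.lessThan_Suc_shift del: sum.lessThan_Suc)

lemma tuple_dist_same_head [simp]: "tuple_dist (x # xs) (x # ys) = tuple_dist xs ys"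
  using tuple_dist_Cons_sq[of x xs x ys] by simp

lemma tuple_dist_same [simp]: "tuple_dist xs xs = 0"
  by (simp add: tuple_dist_def)

lemma tuple_dist_same_tail [simp]: "tuple_dist (x # xs) (y # xs) = dist x y"
  using tuple_dist_Cons_sq[of x xs y xs] by simp

lemma tuple_dist_Cons_ge:
  "dist x y \<le> tuple_dist (x # xs) (y # ys)" "tuple_dist xs ys \<le> tuple_dist (x # xs) (y # ys)"
  by (rule power2_le_imp_le; simp add: tuple_dist_Cons_sq)+

lemma time_tuple_dist_ge:
  "dist (fst p) (fst q) \<le> time_tuple_dist p q" "tuple_dist (snd p) (snd q) \<le> time_tuple_dist p q"
  by (auto simp: time_tuple_dist_def intro!: real_le_rsqrt)

lemma time_tuple_dist_le:
  "time_tuple_dist p q \<le> dist (fst p) (fst q) + tuple_dist (snd p) (snd q)"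
  unfolding time_tuple_dist_def by (rule sqrt_sum_squares_le_sum) auto

lemma norm_vec_le_sum: "norm (x :: 'a::real_normed_vector^'k) \<le> (\<Sum>i\<in>UNIV. norm (x $ i))"
  by (simp add: norm_vec_def L2_set_le_sum)

lemma pr_nth_dist_le:
  fixes x y :: "'a::real_normed_vector^'k"
  shows "tuple_dist (pr nb i (($) x)) (pr nb i (($) y)) \<le> sqrt (real (Suc (length (nb i)))) * dist x y"
proof -
  have "dist (pr nb i (($) x) ! m) (pr nb i (($) y) ! m) \<le> dist x y"
    if "m < length (pr nb i (($) x))" for m
    using that Finite_Cartesian_Product.norm_nth_le[of "x - y" "(i # nb i) ! m"]
    by (simp add: pr_def dist_norm del: list.map nth_Cons_Suc)
  from tuple_dist_le[OF this] show ?thesis by (simp add: pr_def)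
qed

locale mas =
  fixes nb :: "'k::finite \<Rightarrow> 'k list"
    and f :: "'k \<Rightarrow> (real^'n) list \<Rightarrow> real^'n"
    and D :: "(real^'n) set" and M vmax L1 L2 :: real
  assumes system: "multi_agent_system nb f D M vmax L1 L2"
begin

lemma neighbors: "distinct (nb i)" "i \<notin> set (nb i)"
  and domain: "open D" "D \<noteq> {}"
  and gains: "0 < vmax" "vmax < M" "0 < L1" "0 < L2"
  and drift_bound: "z \<in> tuples D (Suc (length (nb i))) \<Longrightarrow> norm (f i z) \<le> M"
  and invariance: "invariance_assumption nb f D vmax"
  using system unfolding multi_agent_system_def by auto

text \<open>Changing the own state first and the neighbors afterwards combines the two separate
  Lipschitz assumptions; the constants stay apart because the step size condition weighs them
  differently.\<close>

lemma drift_lipschitz: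
  assumes "x \<in> D" "y \<in> D" "xs \<in> tuples D (length (nb i))" "ys \<in> tuples D (length (nb i))"
  shows "norm (f i (x # xs) - f i (y # ys)) \<le> L2 * dist x y + L1 * tuple_dist xs ys"
proof -
  have "norm (f i (x # xs) - f i (y # xs)) \<le> L2 * tuple_dist (x # xs) (y # xs)"
    using system assms unfolding multi_agent_system_def by blast
  moreover have "norm (f i (y # xs) - f i (y # ys)) \<le> L1 * tuple_dist (y # xs) (y # ys)"
    using system assms unfolding multi_agent_system_def by blast
  ultimately show ?thesis
    using norm_triangle_ineq[of "f i (x # xs) - f i (y # xs)" "f i (y # xs) - f i (y # ys)"] by simp
qed

lemma drift_lipschitz_tuple:
  assumes "z \<in> tuples D (Suc (length (nb i)))" "z' \<in> tuples D (Suc (length (nb i)))"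
  shows "norm (f i z - f i z') \<le> (L1 + L2) * tuple_dist z z'"
proof -
  obtain x xs y ys where z: "z = x # xs" "z' = y # ys"
    using assms by (auto simp: tuples_def length_Suc_conv)
  have "norm (f i z - f i z') \<le> L2 * dist x y + L1 * tuple_dist xs ys"
    unfolding z by (rule drift_lipschitz) (use assms z in \<open>auto simp: tuples_def\<close>)
  also have "\<dots> \<le> L2 * tuple_dist z z' + L1 * tuple_dist z z'"
    unfolding z using gains by (intro add_mono mult_left_mono tuple_dist_Cons_ge) auto
  finally show ?thesis by (simp add: algebra_simps)
qed

section \<open>The stacked system on \<open>D^N\<close>\<close>

definition U :: "(real^'n^'k) set" where "U = {x. \<forall>i. x $ i \<in> D}"

definition F :: "real^'n^'k \<Rightarrow> real^'n^'k" where "F x = (\<chi> i. f i (pr nb i (($) x)))"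

lemma open_U: "open U"
proof -
  have "U = (\<Inter>i. (\<lambda>x. x $ i) -` D)" by (auto simp: U_def)
  thus ?thesis by (simp add: open_INT open_vimage domain continuous_on_component)
qed

lemma pr_tuples: "x \<in> U \<Longrightarrow> pr nb i (($) x) \<in> tuples D (Suc (length (nb i)))"
  by (auto simp: pr_def tuples_def U_def)

lemma F_bound: "x \<in> U \<Longrightarrow> norm (F x $ i) \<le> M"
  by (simp add: F_def drift_bound pr_tuples)

text \<open>A Lipschitz constant of \<open>F\<close>, obtained by summing over components. It
  involves the drift only, which makes the distortion of open loop flows uniform in the
  input.\<close>

definition K :: real where
  "K = (\<Sum>i\<in>UNIV. (L1 + L2) * sqrt (real (Suc (length (nb i)))))"

lemma K_nonneg: "0 \<le> K"
  using gains by (auto simp: K_def intro!: sum_nonneg)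

lemma F_lipschitz:
  assumes "x \<in> U" "y \<in> U"
  shows "norm (F x - F y) \<le> K * norm (x - y)"
proof -
  have "norm (F x - F y) \<le> (\<Sum>i\<in>UNIV. norm ((F x - F y) $ i))" by (rule norm_vec_le_sum)
  also have "\<dots> \<le> (\<Sum>i\<in>UNIV. (L1 + L2) * sqrt (real (Suc (length (nb i)))) * norm (x - y))"
  proof (rule sum_mono)
    fix i
    have "norm ((F x - F y) $ i) \<le> (L1 + L2) * tuple_dist (pr nb i (($) x)) (pr nb i (($) y))"
      using drift_lipschitz_tuple[OF pr_tuples[OF assms(1)] pr_tuples[OF assms(2)]] by (simp add: F_def)
    also have "\<dots> \<le> (L1 + L2) * (sqrt (real (Suc (length (nb i)))) * dist x y)"
      using gains by (intro mult_left_mono pr_nth_dist_le) auto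
    finally show "norm ((F x - F y) $ i) \<le> (L1 + L2) * sqrt (real (Suc (length (nb i)))) * norm (x - y)"
      by (simp add: dist_norm mult.assoc)
  qed
  also have "\<dots> = K * norm (x - y)" by (simp add: K_def sum_distrib_right)
  finally show ?thesis .
qed

definition H :: "('k \<Rightarrow> real \<Rightarrow> (real^'n) list \<Rightarrow> real^'n) \<Rightarrow> real \<Rightarrow> real^'n^'k \<Rightarrow> real^'n^'k" where
  "H G t x = (\<chi> m. G m t (pr nb m (($) x)))"

text \<open>There are finitely many agents, so the smallest radius and the sum of the constants work
  for all components at once.\<close>

lemma H_locally_lipschitz:
  assumes G: "\<And>m. locally_lipschitz_tuple (A m \<times> tuples D (Suc (length (nb m)))) (G m)"
    and T: "\<And>m. T \<subseteq> A m"
  shows "locally_lipschitz_on T U (H G)"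
  unfolding locally_lipschitz_on_def
proof (intro ballI)
  fix t x assume t: "t \<in> T" and x: "x \<in> U"
  let ?p = "\<lambda>m (x :: real^'n^'k). pr nb m (($) x)"
  \<comment> \<open>\<open>?q m\<close> is a Lipschitz constant of passing from the stacked state to
    the tuple that agent \<open>m\<close> sees, as \<open>td\<close> shows.\<close>
  let ?q = "\<lambda>m. 1 + sqrt (real (Suc (length (nb m))))"
  have "\<forall>m. \<exists>e>0. \<exists>C. \<forall>q\<in>A m \<times> tuples D (Suc (length (nb m))). \<forall>r\<in>A m \<times> tuples D (Suc (length (nb m))).
      time_tuple_dist (t, ?p m x) q < e \<longrightarrow> time_tuple_dist (t, ?p m x) r < e \<longrightarrow>
      dist (G m (fst q) (snd q)) (G m (fst r) (snd r)) \<le> C * time_tuple_dist q r"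
    using G T t pr_tuples[OF x] unfolding locally_lipschitz_tuple_def by blast
  then obtain e C where e: "\<And>m. e m > 0" and C:
    "\<And>m. \<forall>q\<in>A m \<times> tuples D (Suc (length (nb m))). \<forall>r\<in>A m \<times> tuples D (Suc (length (nb m))).
      time_tuple_dist (t, ?p m x) q < e m \<longrightarrow> time_tuple_dist (t, ?p m x) r < e m \<longrightarrow>
      dist (G m (fst q) (snd q)) (G m (fst r) (snd r)) \<le> C m * time_tuple_dist q r"
    by metis
  have q: "?q m > 0" for m by (simp add: add_pos_nonneg)
  have td: "time_tuple_dist (s, ?p m y) (s', ?p m y') \<le> ?q m * (dist s s' + dist y y')" for m s s' y y'
  proof -
    have "time_tuple_dist (s, ?p m y) (s', ?p m y') \<le> dist s s' + tuple_dist (?p m y) (?p m y')"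
      using time_tuple_dist_le[of "(s, ?p m y)" "(s', ?p m y')"] by simp
    also have "\<dots> \<le> dist s s' + sqrt (real (Suc (length (nb m)))) * dist y y'"
      by (intro add_left_mono pr_nth_dist_le)
    also have "\<dots> \<le> ?q m * (dist s s' + dist y y')" by (simp add: algebra_simps)
    finally show ?thesis .
  qed
  \<comment> \<open>The factor 2 accounts for one \<open>d\<close> in time and one in the
    state.\<close>
  define d where "d = Min (range (\<lambda>m. e m / (2 * ?q m)))"
  have d0: "d > 0" unfolding d_def using e q by (subst Min_gr_iff) (auto intro!: divide_pos_pos mult_pos_pos simp del: of_nat_Suc distrib_left_numeral)
  have dm: "?q m * (2 * d) \<le> e m" for m
  proof -
    have "d \<le> e m / (2 * ?q m)" unfolding d_def by (rule Min_le) auto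
    thus ?thesis using q[of m] by (simp add: field_simps)
  qed
  \<comment> \<open>Absolute values, because \<open>locally_lipschitz_tuple\<close> puts no sign
    condition on its constants.\<close>
  define B where "B = (\<Sum>m\<in>UNIV. \<bar>C m\<bar> * ?q m)"
  have "dist (H G s y) (H G s' y') \<le> B * (dist s s' + dist y y')"
    if h: "s \<in> T" "s' \<in> T" "y \<in> U" "y' \<in> U" "dist s t < d" "dist s' t < d" "dist y x < d" "dist y' x < d"
    for s s' y y'
  proof -
    have near: "time_tuple_dist (t, ?p m x) (r, ?p m z) < e m" if "dist r t < d" "dist z x < d" for m r z
    proof -
      have "time_tuple_dist (t, ?p m x) (r, ?p m z) \<le> ?q m * (dist t r + dist x z)" by (rule td)
      also have "\<dots> < ?q m * (2 * d)"
        using that q[of m] by (intro mult_strict_left_mono) (auto simp: dist_commute)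
      finally show ?thesis using dm[of m] by linarith
    qed
    have "dist (H G s y) (H G s' y') \<le> (\<Sum>m\<in>UNIV. norm ((H G s y - H G s' y') $ m))"
      unfolding dist_norm by (rule norm_vec_le_sum)
    also have "\<dots> \<le> (\<Sum>m\<in>UNIV. \<bar>C m\<bar> * ?q m * (dist s s' + dist y y'))"
    proof (rule sum_mono)
      fix m
      have "dist (G m s (?p m y)) (G m s' (?p m y')) \<le> C m * time_tuple_dist (s, ?p m y) (s', ?p m y')"
        using C[of m, rule_format, of "(s, ?p m y)" "(s', ?p m y')"] near[of s y m] near[of s' y' m]
          h T[of m] pr_tuples by auto
      also have "\<dots> \<le> \<bar>C m\<bar> * time_tuple_dist (s, ?p m y) (s', ?p m y')"
        by (intro mult_right_mono) (auto simp: time_tuple_dist_def)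
      also have "\<dots> \<le> \<bar>C m\<bar> * (?q m * (dist s s' + dist y y'))"
        by (intro mult_left_mono td) auto
      finally show "norm ((H G s y - H G s' y') $ m) \<le> \<bar>C m\<bar> * ?q m * (dist s s' + dist y y')"
        by (simp add: H_def dist_norm mult.assoc)
    qed
    also have "\<dots> = B * (dist s s' + dist y y')" by (simp add: B_def sum_distrib_right)
    finally show ?thesis .
  qed
  moreover have "B \<ge> 0" unfolding B_def by (intro sum_nonneg mult_nonneg_nonneg) (auto simp: add_nonneg_nonneg)
  ultimately show "\<exists>e>0. \<exists>C\<ge>0. \<forall>s\<in>T. \<forall>s'\<in>T. \<forall>y\<in>U. \<forall>y'\<in>U.
      dist s t < e \<longrightarrow> dist s' t < e \<longrightarrow> dist y x < e \<longrightarrow> dist y' x < e \<longrightarrow>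
      dist (H G s y) (H G s' y') \<le> C * (dist s s' + dist y y')"
    using d0 by blast
qed

lemma closed_loop_locally_lipschitz:
  assumes "locally_lipschitz_on T U V"
  shows "locally_lipschitz_on T U (\<lambda>t x. F x + V t x)"
  unfolding locally_lipschitz_on_def
proof (intro ballI)
  fix t x assume t: "t \<in> T" and x: "x \<in> U"
  then obtain e C where e: "e > 0" "C \<ge> 0" and C: "\<forall>s\<in>T. \<forall>s'\<in>T. \<forall>y\<in>U. \<forall>y'\<in>U.
      dist s t < e \<longrightarrow> dist s' t < e \<longrightarrow> dist y x < e \<longrightarrow> dist y' x < e \<longrightarrow>
      dist (V s y) (V s' y') \<le> C * (dist s s' + dist y y')"
    using assms unfolding locally_lipschitz_on_def by blast
  have "dist (F y + V s y) (F y' + V s' y') \<le> (K + C) * (dist s s' + dist y y')"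
    if "s \<in> T" "s' \<in> T" "y \<in> U" "y' \<in> U" "dist s t < e" "dist s' t < e" "dist y x < e" "dist y' x < e"
    for s s' y y'
  proof -
    have "dist (F y + V s y) (F y' + V s' y') \<le> dist (F y) (F y') + dist (V s y) (V s' y')"
      by (rule dist_triangle_add)
    also have "\<dots> \<le> K * dist y y' + C * (dist s s' + dist y y')"
      using F_lipschitz[OF that(3,4)] C[rule_format, OF that] by (intro add_mono) (auto simp: dist_norm)
    also have "\<dots> \<le> (K + C) * (dist s s' + dist y y')" using K_nonneg by (simp add: algebra_simps)
    finally show ?thesis .
  qed
  thus "\<exists>e>0. \<exists>C\<ge>0. \<forall>s\<in>T. \<forall>s'\<in>T. \<forall>y\<in>U. \<forall>y'\<in>U.
      dist s t < e \<longrightarrow> dist s' t < e \<longrightarrow> dist y x < e \<longrightarrow> dist y' x < e \<longrightarrow>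
      dist (F y + V s y) (F y' + V s' y') \<le> C * (dist s s' + dist y y')"
    using e K_nonneg by (intro exI[of _ e] exI[of _ "K + C"] conjI) auto
qed

section \<open>Solutions remain in \<open>D^N\<close>\<close>

text \<open>For a continuous input, \<open>mas_solution\<close> demands the equation at every time,
  so the Invariance Assumption yields a solution in the sense of
  \<open>ode_solution\<close>.\<close>

lemma open_loop_exists:
  assumes u: "continuous_on UNIV u" and bnd: "\<And>t i. 0 \<le> t \<Longrightarrow> norm (u t $ i) \<le> vmax" and x0: "x0 \<in> U"
  shows "\<exists>x. x 0 = x0 \<and> ode_solution (\<lambda>t x. F x + u t) U {0..} x"
proof -
  have cu: "continuous (at t within X) u" for t X
    using u continuous_on_eq_continuous_at continuous_at_imp_continuous_at_within by blast
  have "piecewise_continuous u"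
    unfolding piecewise_continuous_def
  proof (intro conjI allI impI)
    show "finite {t \<in> {0..b}. \<not> continuous (at t within {0..}) u}" for b using cu by simp
    show "\<exists>a. (u \<longlongrightarrow> a) (at_right t)" "\<exists>a. (u \<longlongrightarrow> a) (at_left t)" for t
      using cu[of t] unfolding continuous_within by auto
  qed
  then obtain x where x: "mas_solution nb f D u {0..} x" "x 0 = x0"
    using invariance x0 bnd unfolding invariance_assumption_def U_def by blast
  have "ode_solution (\<lambda>t x. F x + u t) U {0..} x"
    using x(1) cu unfolding mas_solution_def ode_solution_def has_vector_derivative_cart
    by (auto simp: U_def F_def)
  thus ?thesis using x(2) by blast
qed

text \<open>
  Freezing the input shortly before the time \<open>\<tau>\<close> gives an open loop system whose flow maps a fixed
  ball around \<open>x 0\<close> onto a neighborhood of the limit of \<open>x\<close>, and it maps into \<open>U\<close> by invariance.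
\<close>

lemma closed_loop_limit:
  assumes \<tau>: "0 < \<tau>" and x: "ode_solution (\<lambda>t x. F x + V t x) U {0..<\<tau>} x"
    and V: "continuous_on {0..<\<tau>} (\<lambda>t. V t (x t))"
    and bnd: "\<And>t i. t \<in> {0..<\<tau>} \<Longrightarrow> norm (V t (x t) $ i) \<le> vmax"
  shows "\<exists>b\<in>U. (x \<longlongrightarrow> b) (at_left \<tau>)"
proof -
  define B where "B = real CARD('k) * (M + vmax)"
  have B: "B > 0" using gains by (simp add: B_def)
  have speed: "norm (F y + v) \<le> B" if "y \<in> U" "\<And>i. norm (v $ i) \<le> vmax" for y v
  proof -
    have "norm (F y + v) \<le> (\<Sum>i\<in>UNIV. norm ((F y + v) $ i))" by (rule norm_vec_le_sum)
    also have "\<dots> \<le> (\<Sum>i\<in>(UNIV::'k set). M + vmax)"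
    proof (rule sum_mono)
      fix i
      show "norm ((F y + v) $ i) \<le> M + vmax"
        using F_bound[OF that(1), of i] that(2)[of i] norm_triangle_ineq[of "F y $ i" "v $ i"] by simp
    qed
    finally show ?thesis by (simp add: B_def)
  qed
  have xlip: "norm (x t - x s) \<le> B * (t - s)" if "0 \<le> s" "s \<le> t" "t < \<tau>" for s t
  proof (rule speed_bound[OF that(2)])
    have sub: "{s..t} \<subseteq> {0..<\<tau>}" using that by auto
    show "continuous_on {s..t} x"
      by (rule ode_solution_continuous[OF ode_solution_subset[OF x sub]])
    fix r assume r: "s < r" "r < t"
    have "(x has_vector_derivative F (x r) + V r (x r)) (at r within {s..t})"
      using ode_solutionD(2)[OF ode_solution_subset[OF x sub], of r] r by simp
    hence "(x has_vector_derivative F (x r) + V r (x r)) (at r)" using r by (simp add: at_within_Icc_at)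
    moreover have "norm (F (x r) + V r (x r)) \<le> B"
      using r that by (intro speed bnd ode_solutionD(1)[OF x]) auto
    ultimately show "\<exists>v. (x has_vector_derivative v) (at r) \<and> norm v \<le> B" by blast
  qed
  \<comment> \<open>Bounded speed gives a limit \<open>b\<close> at \<open>\<tau>\<close>; the
    remaining issue is that \<open>b\<close> could lie on the boundary of \<open>U\<close>.\<close>
  have "B-lipschitz_on {0..<\<tau>} x"
  proof (rule lipschitz_onI)
    fix s t assume "s \<in> {0..<\<tau>}" "t \<in> {0..<\<tau>}"
    thus "dist (x s) (x t) \<le> B * dist s t"
      using xlip[of s t] xlip[of t s] by (cases "s \<le> t") (auto simp: dist_norm norm_minus_commute)
  qed (use B in simp)
  hence "uniformly_continuous_on {0..<\<tau>} x" by (rule lipschitz_on_uniformly_continuous)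
  moreover have "\<tau> \<in> closure {0..<\<tau>}" using \<tau> by simp
  ultimately obtain b where b0: "(x \<longlongrightarrow> b) (at \<tau> within {0..<\<tau>})"
    by (rule uniformly_continuous_on_extension_at_closure)
  have "at \<tau> within {0..<\<tau>} = at_left \<tau>"
    by (rule at_within_nhd[of \<tau> "{0<..}"]) (use \<tau> in auto)
  hence b: "(x \<longlongrightarrow> b) (at_left \<tau>)" using b0 by simp
  have bx: "norm (b - x s) \<le> B * (\<tau> - s)" if s: "0 \<le> s" "s < \<tau>" for s
  proof (rule Lim_norm_ubound[of "at_left \<tau>"])
    show "((\<lambda>t. x t - x s) \<longlongrightarrow> b - x s) (at_left \<tau>)" by (intro tendsto_intros b)
    have "eventually (\<lambda>t. t \<in> {s<..<\<tau>}) (at_left \<tau>)" using s by (intro eventually_at_left_real) auto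
    thus "eventually (\<lambda>t. norm (x t - x s) \<le> B * (\<tau> - s)) (at_left \<tau>)"
    proof eventually_elim
      case (elim t)
      have "norm (x t - x s) \<le> B * (t - s)" using elim s by (intro xlip) auto
      also have "\<dots> \<le> B * (\<tau> - s)" using elim B by (intro mult_left_mono) auto
      finally show ?case .
    qed
  qed simp
  have x0: "x 0 \<in> U" using ode_solutionD(1)[OF x, of 0] \<tau> by simp
  obtain \<rho> where \<rho>: "\<rho> > 0" "cball (x 0) \<rho> \<subseteq> U" using open_U x0 open_contains_cball by blast
  define E where "E = exp (K * \<tau>)"
  have E: "E > 0" by (simp add: E_def)
  \<comment> \<open>Chosen so that \<open>2 * (B * \<eta>)\<close> is half the radius
    \<open>\<rho> / E\<close> of the ball that the flow image will be shown to contain.\<close>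
  define \<eta> where "\<eta> = \<rho> / (E * 4 * B)"
  have \<eta>: "\<eta> > 0" using \<rho> E B by (simp add: \<eta>_def)
  define \<sigma> where "\<sigma> = max 0 (\<tau> - \<eta>)"
  have \<sigma>: "0 \<le> \<sigma>" "\<sigma> < \<tau>" "\<tau> - \<sigma> \<le> \<eta>" using \<eta> \<tau> by (auto simp: \<sigma>_def)
  \<comment> \<open>Along \<open>x\<close> the input is followed up to \<open>\<sigma>\<close> and
    then kept constant; since \<open>\<sigma> < \<tau>\<close>, it is continuous on the whole line
    and still bounded by \<open>vmax\<close>.\<close>
  define u where "u t = V (max 0 (min t \<sigma>)) (x (max 0 (min t \<sigma>)))" for t
  have cl: "max 0 (min t \<sigma>) \<in> {0..<\<tau>}" for t using \<sigma> by auto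
  have "continuous_on UNIV u"
    unfolding u_def
    by (rule continuous_on_compose2[OF V]) (use cl in \<open>auto intro!: continuous_intros\<close>)
  moreover have ub: "norm (u t $ i) \<le> vmax" for t i unfolding u_def by (rule bnd[OF cl])
  ultimately have "\<forall>y\<in>U. \<exists>z. z 0 = y \<and> ode_solution (\<lambda>t x. F x + u t) U {0..} z"
    using open_loop_exists by blast
  then obtain Z where Z: "\<And>y. y \<in> U \<Longrightarrow> Z y 0 = y"
    "\<And>y. y \<in> U \<Longrightarrow> ode_solution (\<lambda>t x. F x + u t) U {0..} (Z y)" by metis
  \<comment> \<open>The common input cancels in the derivative of the difference, so only
    \<open>K\<close> appears, in both directions of time.\<close>
  have gr: "norm (p t - q t) \<le> exp (K * t) * norm (p 0 - q 0) \<and>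
      norm (p 0 - q 0) \<le> exp (K * t) * norm (p t - q t)"
    if t: "0 \<le> t" and p: "ode_solution (\<lambda>t x. F x + u t) U {0..t} p"
      and q: "ode_solution (\<lambda>t x. F x + u t) U {0..t} q" for p q t
  proof -
    have der: "((\<lambda>s. p s - q s) has_vector_derivative F (p s) - F (q s)) (at s within {0..t})"
      if s: "s \<in> {0..t}" for s
      using has_vector_derivative_diff[OF ode_solutionD(2)[OF p s] ode_solutionD(2)[OF q s]] by simp
    have le: "norm (F (p s) - F (q s)) \<le> K * norm (p s - q s)" if s: "s \<in> {0..t}" for s
      by (intro F_lipschitz ode_solutionD(1)[OF p s] ode_solutionD(1)[OF q s])
    show ?thesis
      using gronwall_norm(1)[OF t der le] gronwall_norm(2)[OF t der le] by simp
  qed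
  define \<Phi> where "\<Phi> y = Z y \<tau>" for y
  have Zt: "ode_solution (\<lambda>t x. F x + u t) U {0..t} (Z y)" if "y \<in> U" for y t
    by (rule ode_solution_subset[OF Z(2)[OF that]]) auto
  \<comment> \<open>\<open>E\<close> depends on \<open>\<tau>\<close> and \<open>K\<close> but not
    on \<open>\<sigma>\<close>; therefore \<open>\<sigma>\<close> could be chosen in terms of
    \<open>E\<close>.\<close>
  have \<Phi>: "dist (\<Phi> y) (\<Phi> z) \<le> E * dist y z" "1 / E * dist y z \<le> dist (\<Phi> y) (\<Phi> z)"
    if "y \<in> cball (x 0) \<rho>" "z \<in> cball (x 0) \<rho>" for y z
    using gr[of \<tau> "Z y" "Z z"] Zt Z(1) that \<rho> \<tau> E
    by (auto simp: \<Phi>_def E_def dist_norm field_simps subset_iff)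
  have "ball (\<Phi> (x 0)) (1 / E * \<rho>) \<subseteq> \<Phi> ` cball (x 0) \<rho>"
  proof (rule ball_subset_image_expanding)
    have "E-lipschitz_on (cball (x 0) \<rho>) \<Phi>" using \<Phi>(1) E by (intro lipschitz_onI) auto
    thus "continuous_on (cball (x 0) \<rho>) \<Phi>" by (rule lipschitz_on_continuous_on)
  qed (use \<Phi>(2) E \<rho> in auto)
  moreover have "\<Phi> ` cball (x 0) \<rho> \<subseteq> U"
    using ode_solutionD(1)[OF Z(2), of _ \<tau>] \<tau> \<rho> by (auto simp: \<Phi>_def)
  moreover have "b \<in> ball (\<Phi> (x 0)) (1 / E * \<rho>)"
  proof -
    let ?z = "Z (x 0)"
    have "ode_solution (\<lambda>t x. F x + u t) U {0..\<sigma>} x"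
      unfolding ode_solution_def
    proof
      fix t assume t: "t \<in> {0..\<sigma>}"
      have "ode_solution (\<lambda>t x. F x + V t x) U {0..\<sigma>} x"
        using \<sigma> by (intro ode_solution_subset[OF x]) auto
      thus "x t \<in> U \<and> (x has_vector_derivative F (x t) + u t) (at t within {0..\<sigma>})"
        using t by (simp add: ode_solution_def u_def)
    qed
    hence "norm (?z \<sigma> - x \<sigma>) \<le> exp (K * \<sigma>) * norm (?z 0 - x 0)"
      using gr[OF \<sigma>(1) Zt[OF x0]] by blast
    hence zx: "?z \<sigma> = x \<sigma>" using Z(1)[OF x0] by simp
    have "norm (?z \<tau> - ?z \<sigma>) \<le> B * (\<tau> - \<sigma>)"
    proof (rule speed_bound)
      have sub: "{\<sigma>..\<tau>} \<subseteq> {0..\<tau>}" using \<sigma> by auto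
      show "continuous_on {\<sigma>..\<tau>} ?z"
        by (rule ode_solution_continuous[OF ode_solution_subset[OF Zt[OF x0] sub]])
      fix r assume r: "\<sigma> < r" "r < \<tau>"
      have "(?z has_vector_derivative F (?z r) + u r) (at r within {0..\<tau>})"
        using ode_solutionD(2)[OF Zt[OF x0], of r \<tau>] r \<sigma> by simp
      hence "(?z has_vector_derivative F (?z r) + u r) (at r)" using r \<sigma> by (simp add: at_within_Icc_at)
      moreover have "norm (F (?z r) + u r) \<le> B"
        using r \<sigma> by (intro speed ub ode_solutionD(1)[OF Z(2)[OF x0]]) auto
      ultimately show "\<exists>v. (?z has_vector_derivative v) (at r) \<and> norm v \<le> B" by blast
    qed (use \<sigma> in auto)
    hence "dist b (\<Phi> (x 0)) \<le> 2 * (B * (\<tau> - \<sigma>))"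
      using bx[OF \<sigma>(1,2)] dist_triangle2[of b "?z \<tau>" "x \<sigma>"] zx by (simp add: \<Phi>_def dist_norm)
    also have "\<dots> \<le> 2 * (B * \<eta>)" using \<sigma> B by (intro mult_left_mono) auto
    also have "\<dots> = 1 / E * \<rho> / 2" using B E by (simp add: \<eta>_def field_simps)
    also have "\<dots> < 1 / E * \<rho>" using E \<rho> by (simp add: field_simps)
    finally show ?thesis by (simp add: dist_commute)
  qed
  ultimately have "b \<in> U" by blast
  thus ?thesis using b by blast
qed

lemma closed_loop_near:
  assumes x: "ode_solution (\<lambda>t x. F x + V t x) U {0..t} x" and t: "0 \<le> t" "t \<le> dt"
    and bnd: "\<And>s y m. s \<in> {0..dt} \<Longrightarrow> y \<in> U \<Longrightarrow> (\<And>k. norm (y $ k - x 0 $ k) \<le> (M + vmax) * dt) \<Longrightarrow>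
        norm (V s y $ m) \<le> vmax"
  shows "norm (x t $ m - x 0 $ m) \<le> (M + vmax) * t"
proof (rule componentwise_speed_bound[where \<delta> = dt and V = "\<lambda>s m. (F (x s) + V s (x s)) $ m"])
  fix s k assume s: "s \<in> {0..t}"
  show "((\<lambda>s. x s $ k) has_vector_derivative (F (x s) + V s (x s)) $ k) (at s within {0..t})"
    using ode_solutionD(2)[OF x s] unfolding has_vector_derivative_cart by blast
  assume *: "\<And>k. norm (x s $ k - x 0 $ k) \<le> (M + vmax) * dt"
  have "norm (V s (x s) $ k) \<le> vmax"
    using * s t by (intro bnd ode_solutionD(1)[OF x s]) auto
  thus "norm ((F (x s) + V s (x s)) $ k) \<le> M + vmax"
    using F_bound[OF ode_solutionD(1)[OF x s], of k] norm_triangle_ineq[of "F (x s) $ k" "V s (x s) $ k"]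
    by simp
qed (use t gains in auto)

text \<open>A solution on \<open>{0..<\<tau>}\<close> stays where the inputs are admissible;
  \<open>closed_loop_limit\<close> then supplies the limit in \<open>U\<close> that continuation
  requires.\<close>

lemma closed_loop_exists:
  assumes dt: "0 < dt" and x0: "x0 \<in> U"
    and V: "locally_lipschitz_on {0..dt} U V"
    and bnd: "\<And>t y m. t \<in> {0..dt} \<Longrightarrow> y \<in> U \<Longrightarrow> (\<And>k. norm (y $ k - x0 $ k) \<le> (M + vmax) * dt) \<Longrightarrow>
        norm (V t y $ m) \<le> vmax"
  shows "\<exists>x. x 0 = x0 \<and> ode_solution (\<lambda>t x. F x + V t x) U {0..dt} x"
proof (rule ode_solution_global[OF closed_loop_locally_lipschitz[OF V] open_U _ x0])
  fix \<tau> x assume \<tau>: "0 < \<tau>" "\<tau> \<le> dt" and x: "x 0 = x0" "ode_solution (\<lambda>t x. F x + V t x) U {0..<\<tau>} x"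
  have near: "norm (x t $ m - x 0 $ m) \<le> (M + vmax) * t" if t: "t \<in> {0..<\<tau>}" for t m
    by (rule closed_loop_near[OF ode_solution_subset[OF x(2)], of t dt])
      (use t \<tau> in \<open>auto simp: x(1) intro: bnd\<close>)
  show "\<exists>b\<in>U. (x \<longlongrightarrow> b) (at_left \<tau>)"
  proof (rule closed_loop_limit[OF \<tau>(1) x(2)])
    show "continuous_on {0..<\<tau>} (\<lambda>t. V t (x t))"
      using ode_solutionD(1)[OF x(2)] \<tau>
      by (intro locally_lipschitz_on_compose_continuous[OF V ode_solution_continuous[OF x(2)]]) auto
    fix t i assume t: "t \<in> {0..<\<tau>}"
    have "(M + vmax) * t \<le> (M + vmax) * dt" using t \<tau> gains by (intro mult_left_mono) auto
    thus "norm (V t (x t) $ i) \<le> vmax"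
      using near[OF t] t \<tau> x(1) by (intro bnd ode_solutionD(1)[OF x(2) t]) (auto intro: order_trans)
  qed
qed (use dt in auto)

end

section \<open>Step size and reference trajectories\<close>

lemma between_roots:
  fixes a b d t :: real
  assumes a: "0 < a" and disc: "0 \<le> b\<^sup>2 - 4 * a * d"
    and low: "- sqrt (b\<^sup>2 - 4 * a * d) \<le> 2 * a * t - b"
    and high: "2 * a * t - b \<le> sqrt (b\<^sup>2 - 4 * a * d)"
  shows "a * t\<^sup>2 + d \<le> b * t"
proof -
  have "(2 * a * t - b)\<^sup>2 \<le> (sqrt (b\<^sup>2 - 4 * a * d))\<^sup>2"
    using low high by (intro abs_le_square_iff[THEN iffD1]) auto
  hence "4 * a * (a * t\<^sup>2 + d) \<le> 4 * a * (b * t)"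
    using disc by (simp add: power2_eq_square algebra_simps)
  thus ?thesis using a by simp
qed

text \<open>As \<open>t0\<close> satisfies the inequality, the discriminant is nonnegative and
  \<open>t0\<close> is at least the smaller root; hence so is \<open>t\<close>.\<close>

lemma between_roots_from:
  fixes a b d t :: real
  assumes a: "0 < a" and t0: "a * t0\<^sup>2 + d \<le> b * t0" "t0 \<le> t"
    and high: "2 * a * t - b \<le> sqrt (b\<^sup>2 - 4 * a * d)"
  shows "a * t\<^sup>2 + d \<le> b * t"
proof -
  have "4 * a * (a * t0\<^sup>2 + d) \<le> 4 * a * (b * t0)" using a t0 by (intro mult_left_mono) auto
  hence le: "(2 * a * t0 - b)\<^sup>2 \<le> b\<^sup>2 - 4 * a * d" by (simp add: power2_eq_square algebra_simps)
  hence disc: "0 \<le> b\<^sup>2 - 4 * a * d" by (rule order_trans[OF zero_le_power2])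
  have "\<bar>2 * a * t0 - b\<bar> \<le> sqrt (b\<^sup>2 - 4 * a * d)"
    using real_sqrt_le_mono[OF le] by simp
  moreover have "2 * a * t0 \<le> 2 * a * t" using a t0 by simp
  ultimately show ?thesis by (intro between_roots[OF a disc _ high]) auto
qed

text \<open>Where \<open>dt\<close> is bounded below by \<open>dt_low\<close>, it lies between the
  roots by assumption. Where the lower bound is \<open>mu / (2 * lam * vmax) * d\<close>, the
  assumption \<open>d \<le> d_mu lam mu vmax M L\<close> says that this bound itself satisfies the
  quadratic inequality.\<close>

lemma step_condition:
  fixes lam mu vmax M L d dt :: real
  assumes pos: "0 < M" "0 < L" "0 < vmax" "0 < lam" "lam < 1" "0 < mu"
    and C: "condition_I lam mu vmax M L d dt \<or> condition_II lam mu vmax M L d dt \<or>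
      condition_III lam mu vmax M L d dt"
  shows "M * L * dt\<^sup>2 + d \<le> (1 - lam) * vmax * dt"
proof -
  define a b where "a = M * L" and "b = (1 - lam) * vmax"
  have a: "a > 0" using pos by (simp add: a_def)
  have sq: "(1 - lam)\<^sup>2 * vmax\<^sup>2 - 4 * M * L * d = b\<^sup>2 - 4 * a * d"
    by (simp add: a_def b_def power_mult_distrib)
  have low: "dt_low lam vmax M L d \<le> dt \<longleftrightarrow> - sqrt (b\<^sup>2 - 4 * a * d) \<le> 2 * a * dt - b"
  proof -
    have "dt_low lam vmax M L d = (b - sqrt (b\<^sup>2 - 4 * a * d)) / (2 * a)"
      unfolding dt_low_def sq by (simp add: a_def b_def mult.assoc)
    thus ?thesis using a by (simp add: pos_divide_le_eq algebra_simps)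
  qed
  have high: "dt \<le> dt_high lam vmax M L d \<longleftrightarrow> 2 * a * dt - b \<le> sqrt (b\<^sup>2 - 4 * a * d)"
  proof -
    have "dt_high lam vmax M L d = (b + sqrt (b\<^sup>2 - 4 * a * d)) / (2 * a)"
      unfolding dt_high_def sq by (simp add: a_def b_def mult.assoc)
    thus ?thesis using a by (auto simp add: pos_le_divide_eq algebra_simps)
  qed
  have disc: "0 \<le> b\<^sup>2 - 4 * a * d" if "d \<le> (1 - lam)\<^sup>2 * vmax\<^sup>2 / (4 * M * L)"
    using that pos unfolding sq[symmetric] by (simp add: field_simps)
  have start: "a * (mu / (2 * lam * vmax) * d)\<^sup>2 + d \<le> b * (mu / (2 * lam * vmax) * d)"
    if d: "0 < d" "d \<le> d_mu lam mu vmax M L"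
  proof -
    have "mu\<^sup>2 * a * d \<le> 2 * (lam * (1 - lam) * mu - 2 * lam\<^sup>2) * vmax\<^sup>2"
      using d pos by (simp add: d_mu_def a_def field_simps)
    \<comment> \<open>Multiplying by \<open>d / (4 * lam\<^sup>2 * vmax\<^sup>2)\<close> turns the
      bound on \<open>d\<close> into the inequality at
      \<open>mu / (2 * lam * vmax) * d\<close>.\<close>
    hence "d * (mu\<^sup>2 * a * d) \<le> d * (2 * (lam * (1 - lam) * mu - 2 * lam\<^sup>2) * vmax\<^sup>2)"
      using d by (intro mult_left_mono) auto
    hence "d * (mu\<^sup>2 * a * d) / (4 * lam\<^sup>2 * vmax\<^sup>2) \<le>
        d * (2 * (lam * (1 - lam) * mu - 2 * lam\<^sup>2) * vmax\<^sup>2) / (4 * lam\<^sup>2 * vmax\<^sup>2)"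
      by (intro divide_right_mono) auto
    moreover have "d * (mu\<^sup>2 * a * d) / (4 * lam\<^sup>2 * vmax\<^sup>2) = a * (mu / (2 * lam * vmax) * d)\<^sup>2"
      by (simp add: power2_eq_square mult_ac)
    moreover have "d * (2 * (lam * (1 - lam) * mu - 2 * lam\<^sup>2) * vmax\<^sup>2) / (4 * lam\<^sup>2 * vmax\<^sup>2)
        = b * (mu / (2 * lam * vmax) * d) - d"
      using pos by (simp add: b_def power2_eq_square field_simps)
    ultimately show ?thesis by linarith
  qed
  have "a * dt\<^sup>2 + d \<le> b * dt"
    using C unfolding condition_I_def condition_II_def condition_III_def
    by (auto simp: low high intro: between_roots[OF a disc] between_roots_from[OF a start])
  thus ?thesis by (simp add: a_def b_def)
qed

text \<open>The closest point is at least as near as the radial projection of \<open>q\<close>,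
  which is at distance \<open>norm q - v\<close> when \<open>q\<close> is outside the ball.\<close>

lemma norm_closest_point_diff_le:
  fixes q :: "'a::euclidean_space"
  assumes "norm q \<le> v + c" "0 \<le> v" "0 \<le> c"
  shows "norm (closest_point (cball 0 v) q - q) \<le> c"
proof (cases "norm q \<le> v")
  case True
  thus ?thesis using assms by (simp add: closest_point_self)
next
  case False
  have "dist q (closest_point (cball 0 v) q) \<le> dist q ((v / norm q) *\<^sub>R q)"
    using assms False by (intro closest_point_le) auto
  also have "q - (v / norm q) *\<^sub>R q = (1 - v / norm q) *\<^sub>R q" by (simp add: scaleR_diff_left)
  hence "dist q ((v / norm q) *\<^sub>R q) = \<bar>1 - v / norm q\<bar> * norm q" by (simp add: dist_norm)
  also have "\<dots> = norm q - v"
  proof -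
    have "0 < norm q" using False assms by linarith
    moreover from this have "v / norm q < 1" using False by (simp add: divide_less_eq)
    ultimately show ?thesis by (simp add: left_diff_distrib)
  qed
  finally show ?thesis using assms by (simp add: dist_norm norm_minus_commute)
qed

lemma locally_lipschitz_tupleI:
  assumes "\<And>q r. q \<in> A \<Longrightarrow> r \<in> A \<Longrightarrow> dist (g (fst q) (snd q)) (g (fst r) (snd r)) \<le> C * time_tuple_dist q r"
  shows "locally_lipschitz_tuple A g"
  unfolding locally_lipschitz_tuple_def using assms zero_less_one by blast

context mas begin

section \<open>Reference trajectories and closed loop solutions as ODE solutions\<close>

text \<open>The entries of \<open>i # nb i\<close> are distinct, so the tuple can be read as a
  partial map on agents; agents outside this list get an arbitrary element of
  \<open>A\<close>.\<close>

lemma pr_extend: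
  assumes "length zs = Suc (length (nb i))" "set zs \<subseteq> A" "A \<noteq> {}"
  shows "\<exists>g. (\<forall>m. g m \<in> A) \<and> pr nb i g = zs"
proof -
  obtain a where a: "a \<in> A" using assms by auto
  let ?m = "map_of (zip (i # nb i) zs)"
  define g where "g m = (case ?m m of Some v \<Rightarrow> v | None \<Rightarrow> a)" for m
  have "g m \<in> A" for m
    using a assms(2) by (auto simp: g_def split: option.split dest!: map_of_SomeD set_zip_rightD)
  moreover have "pr nb i g = zs"
  proof (rule nth_equalityI)
    show "length (pr nb i g) = length zs" using assms by (simp add: pr_def)
    fix j assume "j < length (pr nb i g)"
    hence j: "j < length (i # nb i)" by (simp add: pr_def)
    have "?m ((i # nb i) ! j) = Some (zs ! j)"
      using neighbors[of i] j assms(1) by (intro map_of_zip_nth) auto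
    thus "pr nb i g ! j = zs ! j" using j by (simp add: pr_def g_def del: list.map nth_Cons_Suc)
  qed
  ultimately show ?thesis by blast
qed

lemma reference_solution_iff:
  "reference_solution f D i z J chi \<longleftrightarrow>
     is_interval J \<and> 0 \<in> J \<and> J \<subseteq> {0..} \<and> chi 0 = hd z \<and> ode_solution (\<lambda>_ x. f i (x # tl z)) D J chi"
  by (auto simp: reference_solution_def ode_solution_def)

lemma reference_locally_lipschitz:
  assumes "z \<in> tuples D (Suc (length (nb i)))"
  shows "locally_lipschitz_on T D (\<lambda>_ x. f i (x # tl z))"
proof -
  have tl: "tl z \<in> tuples D (length (nb i))" using assms by (cases z) (auto simp: tuples_def)
  have "dist (f i (y # tl z)) (f i (y' # tl z)) \<le> L2 * (dist s s' + dist y y')"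
    if "y \<in> D" "y' \<in> D" for s s' :: real and y y'
  proof -
    have "dist (f i (y # tl z)) (f i (y' # tl z)) \<le> L2 * dist y y'"
      using drift_lipschitz[OF that tl tl] by (simp add: dist_norm)
    also have "\<dots> \<le> L2 * (dist s s' + dist y y')" using gains by simp
    finally show ?thesis .
  qed
  thus ?thesis
    unfolding locally_lipschitz_on_def using gains by (intro ballI exI[of _ 1] exI[of _ L2] conjI) auto
qed

lemma reference_trajectory_exists:
  assumes z: "z \<in> tuples D (Suc (length (nb i)))"
  shows "\<exists>J chi. reference_trajectory f D i z J chi"
proof -
  have hd: "hd z \<in> D" using z by (cases z) (auto simp: tuples_def)
  have T: "is_interval {0::real..}" "(0::real) \<in> {0..}" "{0::real..} \<subseteq> {0..}" by (auto simp: is_interval_ci)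
  from ode_solution_greatest[OF reference_locally_lipschitz[OF z] T hd] obtain J chi where
    1: "is_interval J \<and> 0 \<in> J \<and> J \<subseteq> {0..} \<and> chi 0 = hd z \<and> ode_solution (\<lambda>_ x. f i (x # tl z)) D J chi"
    and 2: "\<forall>J' y. is_interval J' \<and> 0 \<in> J' \<and> J' \<subseteq> {0..} \<and> y 0 = hd z \<and>
        ode_solution (\<lambda>_ x. f i (x # tl z)) D J' y \<longrightarrow> J' \<subseteq> J \<and> (\<forall>t\<in>J'. y t = chi t)"
    by (elim exE conjE) (rule that, simp_all)
  have "reference_trajectory f D i z J chi"
    unfolding reference_trajectory_def reference_solution_iff using 1 2 by blast
  thus ?thesis by blast
qed

text \<open>Maximality refers only to extensions of the given \<open>chi\<close>. If
  \<open>J\<close> did not cover \<open>{0..dt}\<close>, it would be contained in it, and by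
  uniqueness \<open>chi0\<close> would be a proper extension.\<close>

lemma reference_trajectory_covers:
  assumes z: "z \<in> tuples D (Suc (length (nb i)))"
    and chi0: "reference_solution f D i z {0..dt} chi0" and dt: "0 \<le> dt"
    and chi: "reference_trajectory f D i z J chi"
  shows "{0..dt} \<subseteq> J"
proof (rule ccontr)
  assume not: "\<not> {0..dt} \<subseteq> J"
  have J: "is_interval J" "0 \<in> J" "J \<subseteq> {0..}" "chi 0 = hd z" "ode_solution (\<lambda>_ x. f i (x # tl z)) D J chi"
    and max: "\<forall>J' chi'. reference_solution f D i z J' chi' \<and> J \<subseteq> J' \<and> (\<forall>t\<in>J. chi' t = chi t) \<longrightarrow> J' = J"
    using chi unfolding reference_trajectory_def reference_solution_iff by auto
  have c0: "chi0 0 = hd z" "ode_solution (\<lambda>_ x. f i (x # tl z)) D {0..dt} chi0"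
    using chi0 unfolding reference_solution_iff by auto
  have seg: "{0..t} \<subseteq> J" if "t \<in> J" for t
    by (auto intro: mem_is_interval_1_I[OF J(1,2) that])
  have sub: "J \<subseteq> {0..dt}"
  proof
    fix t assume t: "t \<in> J"
    hence "\<not> dt < t" using not seg[OF t] by force
    thus "t \<in> {0..dt}" using t J(3) by auto
  qed
  have "chi0 t = chi t" if t: "t \<in> J" for t
  proof (rule ode_solution_unique[OF reference_locally_lipschitz[OF z]])
    show "ode_solution (\<lambda>_ x. f i (x # tl z)) D {0..t} chi0"
      using sub t by (intro ode_solution_subset[OF c0(2)]) auto
    show "ode_solution (\<lambda>_ x. f i (x # tl z)) D {0..t} chi"
      by (rule ode_solution_subset[OF J(5) seg[OF t]])
    show "{0..t} \<subseteq> UNIV" "t \<in> {0..t}" "chi0 0 = chi 0" using t J c0 by auto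
  qed
  hence "{0..dt} = J" using max chi0 sub by blast
  thus False using not by simp
qed

text \<open>With constant input 0 for the other agents, agent \<open>i\<close> can follow its reference trajectory.\<close>

lemma reference_solution_exists:
  assumes z: "z \<in> tuples D (Suc (length (nb i)))" and dt: "0 < dt"
    and small: "L1 * sqrt (real (length (nb i))) * ((M + vmax) * dt) \<le> vmax"
  shows "\<exists>chi. reference_solution f D i z {0..dt} chi"
proof -
  have z': "length z = Suc (length (nb i))" "set z \<subseteq> D" using z by (auto simp: tuples_def)
  have tl: "tl z \<in> tuples D (length (nb i))" using z by (cases z) (auto simp: tuples_def)
  from pr_extend[OF z' domain(2)] obtain g where g: "\<forall>m. g m \<in> D" "pr nb i g = z" by blast
  define x0 :: "real^'n^'k" where "x0 = (\<chi> m. g m)"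
  have x0: "x0 \<in> U" "pr nb i (($) x0) = z" using g by (auto simp: U_def x0_def pr_def)
  \<comment> \<open>The input of agent \<open>i\<close> exchanges the actual neighbor states for the
    reference points, so component \<open>i\<close> of the closed loop obeys the reference equation.
    Neighbors start at their reference points and move by at most \<open>(M + vmax) * dt\<close>, so
    \<open>small\<close> makes the input admissible.\<close>
  define G where "G m t y = (if m = i then f i (hd y # tl z) - f i y else 0)"
    for m and t :: real and y
  have "locally_lipschitz_tuple (UNIV \<times> tuples D (Suc (length (nb m)))) (G m)" for m
  proof (rule locally_lipschitz_tupleI)
    fix q r assume qr: "q \<in> (UNIV :: real set) \<times> tuples D (Suc (length (nb m)))"
      "r \<in> (UNIV :: real set) \<times> tuples D (Suc (length (nb m)))"
    show "dist (G m (fst q) (snd q)) (G m (fst r) (snd r)) \<le> (L2 + (L1 + L2)) * time_tuple_dist q r"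
    proof (cases "m = i")
      case True
      obtain x xs where x: "snd q = x # xs" using qr by (cases "snd q") (auto simp: tuples_def)
      obtain y ys where y: "snd r = y # ys" using qr by (cases "snd r") (auto simp: tuples_def)
      have xy: "x \<in> D" "y \<in> D" using qr x y by (auto simp: tuples_def)
      have "dist (G m (fst q) (snd q)) (G m (fst r) (snd r))
          = norm ((f i (x # tl z) - f i (y # tl z)) - (f i (snd q) - f i (snd r)))"
        using True x y by (simp add: G_def dist_norm algebra_simps)
      also have "\<dots> \<le> norm (f i (x # tl z) - f i (y # tl z)) + norm (f i (snd q) - f i (snd r))"
        by (rule norm_triangle_ineq4)
      also have "\<dots> \<le> L2 * dist x y + (L1 + L2) * tuple_dist (snd q) (snd r)"
        using drift_lipschitz[OF xy tl tl] drift_lipschitz_tuple[of "snd q" i "snd r"] qr True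
        by (intro add_mono) auto
      also have "\<dots> \<le> L2 * time_tuple_dist q r + (L1 + L2) * time_tuple_dist q r"
        using gains tuple_dist_Cons_ge(1)[of x y xs ys] time_tuple_dist_ge(2)[of q r] x y
        by (intro add_mono mult_left_mono) auto
      finally show ?thesis by (simp add: algebra_simps)
    next
      case False
      thus ?thesis using gains by (simp add: G_def time_tuple_dist_def)
    qed
  qed
  hence lip: "locally_lipschitz_on {0..dt} U (H G)" by (rule H_locally_lipschitz) auto
  have "\<exists>x. x 0 = x0 \<and> ode_solution (\<lambda>t x. F x + H G t x) U {0..dt} x"
  proof (rule closed_loop_exists[OF dt x0(1) lip])
    fix t y m assume y: "y \<in> U" "\<And>k. norm (y $ k - x0 $ k) \<le> (M + vmax) * dt"
    show "norm (H G t y $ m) \<le> vmax"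
    proof (cases "m = i")
      case True
      have "norm (H G t y $ m) = norm (f i (y $ i # tl z) - f i (y $ i # map (($) y) (nb i)))"
        using True by (simp add: H_def G_def pr_def)
      also have "\<dots> \<le> L2 * dist (y $ i) (y $ i) + L1 * tuple_dist (tl z) (map (($) y) (nb i))"
        using y(1) by (intro drift_lipschitz tl) (auto simp: U_def tuples_def)
      also have "\<dots> = L1 * tuple_dist (map (($) x0) (nb i)) (map (($) y) (nb i))"
        using x0(2) by (auto simp: pr_def)
      also have "\<dots> \<le> L1 * (sqrt (real (length (map (($) x0) (nb i)))) * ((M + vmax) * dt))"
        using gains dt y(2) by (intro mult_left_mono tuple_dist_le) (auto simp: dist_norm norm_minus_commute)
      also have "\<dots> \<le> vmax" using small by (simp add: mult.assoc)
      finally show ?thesis .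
    next
      case False
      thus ?thesis using gains by (simp add: H_def G_def)
    qed
  qed
  then obtain x where x: "x 0 = x0" "ode_solution (\<lambda>t x. F x + H G t x) U {0..dt} x" by blast
  have "reference_solution f D i z {0..dt} (\<lambda>t. x t $ i)"
    unfolding reference_solution_def
  proof (intro conjI ballI)
    show "x 0 $ i = hd z" using x(1) x0(2) by (auto simp: pr_def)
    fix t assume t: "t \<in> {0..dt}"
    show "x t $ i \<in> D" using ode_solutionD(1)[OF x(2) t] by (simp add: U_def)
    have "((\<lambda>s. x s $ i) has_vector_derivative (F (x t) + H G t (x t)) $ i) (at t within {0..dt})"
      using ode_solutionD(2)[OF x(2) t] unfolding has_vector_derivative_cart by blast
    thus "((\<lambda>s. x s $ i) has_vector_derivative f i (x t $ i # tl z)) (at t within {0..dt})"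
      by (simp add: F_def H_def G_def pr_def)
  qed (use dt in \<open>auto simp: is_interval_cc\<close>)
  thus ?thesis by blast
qed

text \<open>\<open>mas_solution\<close> demands the equation only at times where the input is
  continuous. Along a continuous state in \<open>U\<close>, a locally Lipschitz feedback is
  continuous in time, so there are no exceptional times.\<close>

lemma closed_loop_solution_iff:
  assumes lip: "locally_lipschitz_on {0..dt} U (H (\<lambda>m. feedback (Kf m) (x0 $ m) (w m)))"
  shows "closed_loop_solution nb f D dt Kf w x0 x \<longleftrightarrow>
    x 0 = x0 \<and> ode_solution (\<lambda>t x. F x + H (\<lambda>m. feedback (Kf m) (x0 $ m) (w m)) t x) U {0..dt} x"
proof -
  let ?H = "H (\<lambda>m. feedback (Kf m) (x0 $ m) (w m))"
  have eq: "closed_loop_solution nb f D dt Kf w x0 x \<longleftrightarrow>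
      x 0 = x0 \<and> mas_solution nb f D (\<lambda>t. ?H t (x t)) {0..dt} x" for x
    by (simp add: closed_loop_solution_def H_def)
  show ?thesis
  proof
    assume "closed_loop_solution nb f D dt Kf w x0 x"
    hence x: "x 0 = x0" "mas_solution nb f D (\<lambda>t. ?H t (x t)) {0..dt} x" unfolding eq by auto
    have xU: "x t \<in> U" if "t \<in> {0..dt}" for t using x(2) that by (auto simp: mas_solution_def U_def)
    have "continuous_on {0..dt} (\<lambda>t. ?H t (x t))"
      using x(2) xU by (intro locally_lipschitz_on_compose_continuous[OF lip]) (auto simp: mas_solution_def)
    hence "continuous (at t within {0..dt}) (\<lambda>t. ?H t (x t))" if "t \<in> {0..dt}" for t
      using that by (simp add: continuous_on_eq_continuous_within)
    hence "ode_solution (\<lambda>t x. F x + ?H t x) U {0..dt} x"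
      using x(2) xU unfolding ode_solution_def mas_solution_def has_vector_derivative_cart by (simp add: F_def)
    thus "x 0 = x0 \<and> ode_solution (\<lambda>t x. F x + ?H t x) U {0..dt} x" using x(1) by blast
  next
    assume *: "x 0 = x0 \<and> ode_solution (\<lambda>t x. F x + ?H t x) U {0..dt} x"
    hence "continuous_on {0..dt} x" by (auto intro: ode_solution_continuous)
    thus "closed_loop_solution nb f D dt Kf w x0 x"
      using * unfolding eq mas_solution_def ode_solution_def has_vector_derivative_cart
      by (auto simp: F_def U_def)
  qed
qed

end

section \<open>Reachable cells\<close>

text \<open>The three cases enter only through \<open>small\<close>, stated for each agent with the
  gain that the tracking estimate produces.\<close>

locale discretized_mas = mas nb f D M vmax L1 L2
  for nb :: "'k::finite \<Rightarrow> 'k list"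
    and f :: "'k \<Rightarrow> (real^'n) list \<Rightarrow> real^'n"
    and D M vmax L1 L2 +
  fixes I :: "'l set" and S :: "'l \<Rightarrow> (real^'n) set" and dt lam :: real
  assumes cells: "cell_decomposition D I S"
    and step: "0 < dt" and lam: "0 < lam" "lam < 1"
    and small: "\<And>i. M * (L2 + 3 * L1 * sqrt (real (length (nb i)))) * dt\<^sup>2 + d_max I S \<le> (1 - lam) * vmax * dt"
begin

abbreviation W :: "(real^'n) set" where "W \<equiv> cball 0 (lam * vmax)"

lemma cell_subset: "l \<in> I \<Longrightarrow> S l \<subseteq> D"
  using cells unfolding cell_decomposition_def by blast

lemma cell_dist:
  assumes "l \<in> I" "x \<in> S l" "y \<in> S l"
  shows "dist x y \<le> d_max I S"
proof -
  have "dist x y \<le> diameter (S l)"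
    using cells assms unfolding cell_decomposition_def by (intro diameter_bounded_bound) auto
  also have "\<dots> \<le> d_max I S"
    unfolding d_max_def using cells assms by (intro cSUP_upper) (auto simp: cell_decomposition_def)
  finally show ?thesis .
qed

lemma cell_point: "\<exists>l\<in>I. \<exists>x. x \<in> S l"
proof -
  have "(\<Union>l\<in>I. S l) \<noteq> {}" using domain cells unfolding cell_decomposition_def by simp
  thus ?thesis by blast
qed

lemma d_max_nonneg: "0 \<le> d_max I S"
  using cell_point cell_dist by (metis dist_self)

lemma drift_gain_nonneg: "0 \<le> L2 + 3 * L1 * sqrt (real (length (nb i)))"
  using gains by (intro add_nonneg_nonneg mult_nonneg_nonneg) auto

lemma d_max_le: "d_max I S \<le> (1 - lam) * vmax * dt"
proof -
  have "0 \<le> M * (L2 + 3 * L1 * sqrt (real (length (nb undefined)))) * dt\<^sup>2"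
    using gains drift_gain_nonneg by (intro mult_nonneg_nonneg) auto
  thus ?thesis using small[of undefined] by linarith
qed

text \<open>The budget for the input, as velocities: own deviation from the reference trajectory,
  deviation of the neighbors from their reference points, and removal of the initial offset within
  \<open>dt\<close>. The remaining \<open>lam * vmax\<close> is reserved for
  \<open>w\<close>.\<close>

lemma small_div:
  "L2 * (M * dt) + L1 * (sqrt (real (length (nb i))) * (3 * M * dt)) + d_max I S / dt \<le> (1 - lam) * vmax"
proof -
  have "(L2 * (M * dt) + L1 * (sqrt (real (length (nb i))) * (3 * M * dt)) + d_max I S / dt) * dt
      = M * (L2 + 3 * L1 * sqrt (real (length (nb i)))) * dt\<^sup>2 + d_max I S"
    using step by (simp add: power2_eq_square algebra_simps)
  thus ?thesis using small[of i] step by (metis mult_le_cancel_right_pos)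
qed

lemma reference_solution_on_step:
  assumes z: "z \<in> tuples D (Suc (length (nb i)))"
  shows "\<exists>chi. reference_solution f D i z {0..dt} chi"
proof (rule reference_solution_exists[OF z step])
  have "L1 * (sqrt (real (length (nb i))) * ((M + vmax) * dt)) \<le> L1 * (sqrt (real (length (nb i))) * (3 * M * dt))"
    using gains step by (intro mult_left_mono mult_right_mono) auto
  also have "\<dots> \<le> (1 - lam) * vmax"
  proof -
    have "0 \<le> L2 * (M * dt)" "0 \<le> d_max I S / dt" using gains step d_max_nonneg by auto
    thus ?thesis using small_div[of i] by linarith
  qed
  also have "\<dots> \<le> vmax" using lam gains by (simp add: mult_left_le_one_le)
  finally show "L1 * sqrt (real (length (nb i))) * ((M + vmax) * dt) \<le> vmax" by (simp add: mult.assoc)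
qed

definition feedback_input ::
  "('k \<Rightarrow> (real^'n) feedback_law) \<Rightarrow> ('k \<Rightarrow> real^'n) \<Rightarrow> real^'n^'k \<Rightarrow> real \<Rightarrow> real^'n^'k \<Rightarrow> real^'n^'k" where
  "feedback_input Kf w x0 = H (\<lambda>m. feedback (Kf m) (x0 $ m) (w m))"

text \<open>Turns Property (P) into the hypotheses of \<open>closed_loop_exists\<close>: by (P3) the
  horizons cover \<open>{0..dt}\<close>, and a state that close to \<open>x0\<close> lies in all
  enlarged cells, where (P2) applies.\<close>

lemma feedback_input:
  assumes P: "\<And>m. property_P D S M vmax dt W (pr nb m l) (Kf m)" "\<And>m. w m \<in> W" "\<And>m. x0 $ m \<in> S (l m)"
  shows "locally_lipschitz_on {0..dt} U (feedback_input Kf w x0)"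
    and "\<And>t y m. t \<in> {0..dt} \<Longrightarrow> y \<in> U \<Longrightarrow> (\<And>k. norm (y $ k - x0 $ k) \<le> (M + vmax) * dt) \<Longrightarrow>
        norm (feedback_input Kf w x0 t y $ m) \<le> vmax"
proof -
  have hd: "hd (pr nb m l) = l m" "length (pr nb m l) = Suc (length (nb m))" for m
    by (simp_all add: pr_def)
  let ?A = "\<lambda>m. {t. 0 \<le> t \<and> ereal t < horizon (Kf m) (x0 $ m) (w m)}"
  have Pm: "locally_lipschitz_tuple (?A m \<times> tuples D (Suc (length (nb m)))) (feedback (Kf m) (x0 $ m) (w m)) \<and>
      (\<forall>t z. 0 \<le> t \<and> t \<le> dt \<and> ereal t < horizon (Kf m) (x0 $ m) (w m) \<and> length z = Suc (length (nb m)) \<and>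
        (\<forall>j<Suc (length (nb m)). z ! j \<in> enlarge (S (pr nb m l ! j)) (dt * (M + vmax)) \<inter> D) \<longrightarrow>
        norm (feedback (Kf m) (x0 $ m) (w m) t z) \<le> vmax) \<and>
      ereal dt < horizon (Kf m) (x0 $ m) (w m)" for m
    using P(1)[of m, unfolded property_P_def hd] P(2)[of m] P(3)[of m] by blast
  have sub: "{0..dt} \<subseteq> ?A m" for m
  proof
    fix t assume "t \<in> {0..dt}"
    hence "0 \<le> t" and t: "ereal t \<le> ereal dt" by auto
    have "ereal dt < horizon (Kf m) (x0 $ m) (w m)" using Pm by blast
    with t have "ereal t < horizon (Kf m) (x0 $ m) (w m)" by (rule le_less_trans)
    thus "t \<in> ?A m" using \<open>0 \<le> t\<close> by simp
  qed
  show "locally_lipschitz_on {0..dt} U (feedback_input Kf w x0)"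
    unfolding feedback_input_def
    by (rule H_locally_lipschitz[where A = ?A]) (use Pm sub in auto)
  fix t y m assume t: "t \<in> {0..dt}" and y: "y \<in> U" "\<And>k. norm (y $ k - x0 $ k) \<le> (M + vmax) * dt"
  have "y $ k \<in> enlarge (S (l k)) (dt * (M + vmax)) \<inter> D" for k
  proof -
    have "y $ k = x0 $ k + (y $ k - x0 $ k)" by simp
    moreover have "y $ k - x0 $ k \<in> cball 0 (dt * (M + vmax))" using y(2)[of k] by (simp add: mult.commute)
    ultimately have "y $ k \<in> enlarge (S (l k)) (dt * (M + vmax))"
      unfolding enlarge_def using P(3)[of k] by blast
    thus ?thesis using y(1) by (simp add: U_def)
  qed
  hence "\<forall>j<Suc (length (nb m)). pr nb m (($) y) ! j \<in> enlarge (S (pr nb m l ! j)) (dt * (M + vmax)) \<inter> D"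
    by (simp add: pr_def del: list.map)
  moreover have "length (pr nb m (($) y)) = Suc (length (nb m))" by (simp add: pr_def)
  moreover have "0 \<le> t" "t \<le> dt" "ereal t < horizon (Kf m) (x0 $ m) (w m)" using t sub[of m] by auto
  ultimately have "norm (feedback (Kf m) (x0 $ m) (w m) t (pr nb m (($) y))) \<le> vmax"
    using Pm by blast
  thus "norm (feedback_input Kf w x0 t y $ m) \<le> vmax" by (simp add: feedback_input_def H_def)
qed

text \<open>
  Saturating the tracking law makes (P2) trivial; along closed loop solutions the saturation turns
  out to be inactive.
\<close>

definition tracking_law ::
  "'k \<Rightarrow> (real^'n) list \<Rightarrow> (real \<Rightarrow> real^'n) \<Rightarrow> (real^'n) feedback_law" where
  "tracking_law i z chi = \<lparr>horizon = (\<lambda>x0 w. \<infinity>),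
     feedback = (\<lambda>x0 w t y. closest_point (cball 0 vmax)
       (f i (chi (max 0 (min t dt)) # tl z) + (1 / dt) *\<^sub>R (hd z - x0) + w - f i y))\<rparr>"

lemma closest_point_vmax: "norm (closest_point (cball 0 vmax) q) \<le> vmax"
  using closest_point_in_set[of "cball 0 vmax" q] gains by auto

lemma tracking_law_property_P:
  assumes z: "z \<in> tuples D (Suc (length (nb i)))" and len: "length li = Suc (length (nb i))"
    and chi: "reference_solution f D i z {0..dt} chi"
  shows "property_P D S M vmax dt W li (tracking_law i z chi)"
proof -
  have tl: "tl z \<in> tuples D (length (nb i))" using z by (cases z) (auto simp: tuples_def)
  have sol: "ode_solution (\<lambda>_ x. f i (x # tl z)) D {0..dt} chi"
    using chi unfolding reference_solution_iff by auto
  \<comment> \<open>The law is defined for all times, but \<open>chi\<close> is controlled only on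
    \<open>{0..dt}\<close>. Clamping is nonexpansive, so the composition with \<open>chi\<close>
    remains \<open>M\<close>-Lipschitz.\<close>
  define c where "c t = max 0 (min t dt)" for t
  have c: "c t \<in> {0..dt}" "\<bar>c t - c s\<bar> \<le> \<bar>t - s\<bar>" for t s using step by (auto simp: c_def)
  have speed: "norm (chi t - chi s) \<le> M * (t - s)" if "0 \<le> s" "s \<le> t" "t \<le> dt" for s t
  proof (rule speed_bound[OF that(2)])
    have sub: "{s..t} \<subseteq> {0..dt}" using that by auto
    show "continuous_on {s..t} chi"
      by (rule ode_solution_continuous[OF ode_solution_subset[OF sol sub]])
    fix r assume r: "s < r" "r < t"
    have "(chi has_vector_derivative f i (chi r # tl z)) (at r within {s..t})"
      using ode_solutionD(2)[OF ode_solution_subset[OF sol sub], of r] r by simp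
    hence "(chi has_vector_derivative f i (chi r # tl z)) (at r)" using r by (simp add: at_within_Icc_at)
    moreover have "chi r \<in> D" using r that by (intro ode_solutionD(1)[OF sol]) auto
    hence "norm (f i (chi r # tl z)) \<le> M" using tl by (intro drift_bound) (auto simp: tuples_def)
    ultimately show "\<exists>v. (chi has_vector_derivative v) (at r) \<and> norm v \<le> M" by blast
  qed
  have chi_lip: "dist (chi (c t)) (chi (c s)) \<le> M * dist t s" for t s
  proof -
    have "dist (chi (c t)) (chi (c s)) \<le> M * \<bar>c t - c s\<bar>"
      using speed[of "c s" "c t"] speed[of "c t" "c s"] c(1)[of s] c(1)[of t]
      by (cases "c s \<le> c t") (auto simp: dist_norm norm_minus_commute)
    also have "\<dots> \<le> M * dist t s" using c(2)[of t s] gains by (intro mult_left_mono) (auto simp: dist_real_def)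
    finally show ?thesis .
  qed
  have "locally_lipschitz_tuple ({t. 0 \<le> t \<and> ereal t < \<infinity>} \<times> tuples D (length li))
      (feedback (tracking_law i z chi) x0 w)" for x0 w
  proof (rule locally_lipschitz_tupleI)
    fix q r assume qr: "q \<in> {t. 0 \<le> t \<and> ereal t < \<infinity>} \<times> tuples D (length li)"
      "r \<in> {t. 0 \<le> t \<and> ereal t < \<infinity>} \<times> tuples D (length li)"
    let ?a = "\<lambda>q. f i (chi (c (fst q)) # tl z)"
    have D: "chi (c t) \<in> D" for t by (rule ode_solutionD(1)[OF sol c(1)])
    have "dist (feedback (tracking_law i z chi) x0 w (fst q) (snd q))
        (feedback (tracking_law i z chi) x0 w (fst r) (snd r))
      \<le> dist (?a q + (1 / dt) *\<^sub>R (hd z - x0) + w - f i (snd q)) (?a r + (1 / dt) *\<^sub>R (hd z - x0) + w - f i (snd r))"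
      unfolding tracking_law_def c_def using gains
      by (simp del: closest_point_lipschitz) (rule closest_point_lipschitz, auto)
    also have "\<dots> = norm ((?a q - ?a r) - (f i (snd q) - f i (snd r)))"
      by (simp add: dist_norm algebra_simps)
    also have "\<dots> \<le> norm (?a q - ?a r) + norm (f i (snd q) - f i (snd r))" by (rule norm_triangle_ineq4)
    also have "\<dots> \<le> L2 * dist (chi (c (fst q))) (chi (c (fst r))) + (L1 + L2) * tuple_dist (snd q) (snd r)"
      using drift_lipschitz[OF D D tl tl, of "fst q" "fst r"] drift_lipschitz_tuple[of "snd q" i "snd r"] qr len
      by (intro add_mono) auto
    also have "\<dots> \<le> L2 * (M * time_tuple_dist q r) + (L1 + L2) * time_tuple_dist q r"
    proof (intro add_mono mult_left_mono)
      show "dist (chi (c (fst q))) (chi (c (fst r))) \<le> M * time_tuple_dist q r"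
        using chi_lip[of "fst q" "fst r"] mult_left_mono[OF time_tuple_dist_ge(1)[of q r], of M] gains by linarith
    qed (use gains in \<open>auto intro: time_tuple_dist_ge\<close>)
    finally show "dist (feedback (tracking_law i z chi) x0 w (fst q) (snd q))
        (feedback (tracking_law i z chi) x0 w (fst r) (snd r)) \<le> (L2 * M + (L1 + L2)) * time_tuple_dist q r"
      by (simp add: algebra_simps)
  qed
  thus ?thesis
    unfolding property_P_def by (auto simp: tracking_law_def closest_point_vmax)
qed

lemma zero_law_property_P:
  "property_P D S M vmax dt W li \<lparr>horizon = (\<lambda>x0 w. \<infinity>), feedback = (\<lambda>x0 w t y. 0)\<rparr>"
proof -
  have "locally_lipschitz_tuple A (\<lambda>t y. 0 :: real^'n)" for A :: "(real \<times> (real^'n) list) set"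
    by (rule locally_lipschitz_tupleI[where C = 0]) simp
  thus ?thesis unfolding property_P_def using gains by auto
qed

text \<open>The end point depends on \<open>w i\<close> and \<open>chi\<close> alone: neither the
  initial states nor the laws of the other agents influence it. Agent \<open>i\<close> stays on the
  curve \<open>p\<close> because the deviation \<open>e\<close> satisfies a homogeneous Gronwall
  inequality with zero initial value.\<close>

lemma tracking:
  assumes l: "\<And>m. l m \<in> I" and li: "pr nb i l = li"
    and z: "list_all2 (\<lambda>x l. x \<in> S l) z li"
    and chi: "reference_solution f D i z {0..dt} chi"
    and Kf: "Kf i = tracking_law i z chi"
    and P: "\<And>m. property_P D S M vmax dt W (pr nb m l) (Kf m)" and w: "\<And>m. w m \<in> W"
    and x0: "\<And>m. x0 $ m \<in> S (l m)"
  shows "\<exists>x. closed_loop_solution nb f D dt Kf w x0 x"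
    and "\<And>x. closed_loop_solution nb f D dt Kf w x0 x \<Longrightarrow> x dt $ i = chi dt + dt *\<^sub>R w i"
proof -
  let ?V = "feedback_input Kf w x0"
  note input = feedback_input[where l = l and Kf = Kf and w = w and ?x0.0 = x0, OF P w x0]
  note lip = input(1) and bnd = input(2)
  have x0U: "x0 \<in> U" using x0 l cell_subset by (auto simp: U_def)
  have iff: "closed_loop_solution nb f D dt Kf w x0 x \<longleftrightarrow>
      x 0 = x0 \<and> ode_solution (\<lambda>t x. F x + ?V t x) U {0..dt} x" for x
    using closed_loop_solution_iff[of dt Kf x0 w] lip unfolding feedback_input_def by blast
  show "\<exists>x. closed_loop_solution nb f D dt Kf w x0 x"
    unfolding iff by (rule closed_loop_exists[OF step x0U lip bnd])
  fix x assume "closed_loop_solution nb f D dt Kf w x0 x"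
  hence x: "x 0 = x0" "ode_solution (\<lambda>t x. F x + ?V t x) U {0..dt} x" by (auto simp: iff)
  have near: "norm (x t $ m - x0 $ m) \<le> (M + vmax) * dt" if t: "t \<in> {0..dt}" for t m
  proof -
    have "norm (x t $ m - x 0 $ m) \<le> (M + vmax) * t"
      by (rule closed_loop_near[OF ode_solution_subset[OF x(2)], of t dt]) (use t in \<open>auto simp: x(1) intro: bnd\<close>)
    also have "\<dots> \<le> (M + vmax) * dt" using t gains by (intro mult_left_mono) auto
    finally show ?thesis by (simp add: x(1))
  qed
  have lz: "length z = Suc (length (nb i))" using z li by (auto simp: list_all2_lengthD pr_def)
  have zS: "z ! j \<in> S (pr nb i l ! j)" if "j < Suc (length (nb i))" for j
    using list_all2_nthD[OF z, of j] lz li that by simp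
  have zI: "z \<in> tuples D (Suc (length (nb i)))"
  proof -
    have "pr nb i l ! j \<in> I" if "j < Suc (length (nb i))" for j
      using that l by (simp add: pr_def del: list.map)
    thus ?thesis using zS lz cell_subset unfolding tuples_def
      by (fastforce simp: set_conv_nth)
  qed
  obtain z0 zs where zc: "z = z0 # zs" "length zs = length (nb i)" using lz by (cases z) auto
  have z0: "z0 \<in> S (l i)" using zS[of 0] zc by (simp add: pr_def)
  have zs: "zs ! j \<in> S (l (nb i ! j))" if "j < length (nb i)" for j
    using zS[of "Suc j"] zc that by (simp add: pr_def)
  have zsD: "zs \<in> tuples D (length (nb i))" using zI zc by (auto simp: tuples_def)
  have csol: "ode_solution (\<lambda>_ x. f i (x # zs)) D {0..dt} chi" and chi0: "chi 0 = z0"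
    using chi unfolding reference_solution_iff by (auto simp: zc)
  define d where "d = d_max I S"
  have "(1 - lam) * vmax \<le> vmax" using lam gains by (simp add: mult_left_le_one_le)
  hence "(1 - lam) * vmax * dt \<le> vmax * dt" using step by (intro mult_right_mono) auto
  hence d: "0 \<le> d" "d \<le> vmax * dt"
    using d_max_nonneg d_max_le by (auto simp: d_def)
  have dz0: "norm (z0 - x0 $ i) \<le> d" using cell_dist[OF l z0 x0[of i]] by (simp add: d_def dist_norm)
  have wi: "norm (w i) \<le> lam * vmax" using w[of i] by simp
  define p where "p t = x0 $ i + (chi t - z0) + (t / dt) *\<^sub>R (z0 - x0 $ i) + t *\<^sub>R w i" for t
  \<comment> \<open>The unsaturated input: the velocity of \<open>p\<close> minus the current drift
    of agent \<open>i\<close>.\<close>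
  define q where "q t = f i (chi t # zs) + (1 / dt) *\<^sub>R (z0 - x0 $ i) + w i - f i (pr nb i (($) (x t)))" for t
  define e where "e t = x t $ i - p t" for t
  have input_i: "?V t (x t) $ i = closest_point (cball 0 vmax) (q t)" if t: "t \<in> {0..dt}" for t
    using t by (simp add: feedback_input_def H_def Kf tracking_law_def q_def zc)
  have qbound: "norm (q t) \<le> vmax + L2 * norm (e t)" if t: "t \<in> {0..dt}" for t
  proof -
    define s where "s = t / dt"
    have s: "0 \<le> s" "s \<le> 1" "t = s * dt" using t step by (auto simp: s_def)
    have "norm (p t - chi t) \<le> vmax * dt"
    proof -
      \<comment> \<open>A convex combination of \<open>dt *\<^sub>R w i\<close> and
        \<open>x0 $ i - z0\<close>, both of norm at most \<open>vmax * dt\<close>; hence the bound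
        is not the sum of the two.\<close>
      have "p t - chi t = (s * dt) *\<^sub>R w i - (1 - s) *\<^sub>R (z0 - x0 $ i)"
        using step by (simp add: p_def s_def algebra_simps)
      hence "norm (p t - chi t) \<le> (s * dt) * norm (w i) + (1 - s) * norm (z0 - x0 $ i)"
        using norm_triangle_ineq4[of "(s * dt) *\<^sub>R w i" "(1 - s) *\<^sub>R (z0 - x0 $ i)"] s step by simp
      also have "\<dots> \<le> (s * dt) * vmax + (1 - s) * (vmax * dt)"
      proof (intro add_mono mult_left_mono)
        have "lam * vmax \<le> vmax" using lam gains by simp
        thus "norm (w i) \<le> vmax" using wi by linarith
      qed (use s step dz0 d in auto)
      also have "\<dots> = vmax * dt" by (simp add: algebra_simps)
      finally show ?thesis .
    qed
    also have "\<dots> \<le> M * dt" using gains step by simp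
    finally have 1: "dist (chi t) (x t $ i) \<le> M * dt + norm (e t)"
      using norm_triangle_ineq[of "x t $ i - p t" "p t - chi t"]
      by (simp add: dist_norm norm_minus_commute e_def)
    have xU: "x t \<in> U" by (rule ode_solutionD(1)[OF x(2) t])
    have 2: "tuple_dist zs (map (($) (x t)) (nb i)) \<le> sqrt (real (length zs)) * (3 * M * dt)"
    proof (rule tuple_dist_le)
      fix j assume j: "j < length zs"
      let ?k = "nb i ! j"
      \<comment> \<open>Offset within the cell plus distance travelled. With
        \<open>d \<le> vmax * dt\<close> and \<open>vmax < M\<close> the total is at most
        \<open>3 * M * dt\<close>, the origin of the factor 3.\<close>
      have "dist (zs ! j) (x t $ ?k) \<le> dist (zs ! j) (x0 $ ?k) + dist (x0 $ ?k) (x t $ ?k)"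
        by (rule dist_triangle)
      also have "\<dots> \<le> d + (M + vmax) * dt"
        using cell_dist[OF l zs x0, of j] j zc near[OF t, of ?k]
        by (intro add_mono) (auto simp: d_def dist_norm norm_minus_commute)
      also have "\<dots> \<le> 3 * M * dt"
      proof -
        have "vmax * dt \<le> M * dt" using gains step by simp
        thus ?thesis using d by (simp add: algebra_simps)
      qed
      finally show "dist (zs ! j) (map (($) (x t)) (nb i) ! j) \<le> 3 * M * dt" using j zc by simp
    qed (use gains step in auto)
    have "norm (f i (chi t # zs) - f i (x t $ i # map (($) (x t)) (nb i)))
        \<le> L2 * dist (chi t) (x t $ i) + L1 * tuple_dist zs (map (($) (x t)) (nb i))"
      using xU by (intro drift_lipschitz zsD ode_solutionD(1)[OF csol t]) (auto simp: U_def tuples_def)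
    also have "\<dots> \<le> L2 * (M * dt + norm (e t)) + L1 * (sqrt (real (length zs)) * (3 * M * dt))"
      using 1 2 gains by (intro add_mono mult_left_mono) auto
    finally have 3: "norm (f i (chi t # zs) - f i (pr nb i (($) (x t))))
        \<le> L2 * (M * dt) + L2 * norm (e t) + L1 * (sqrt (real (length (nb i))) * (3 * M * dt))"
      using zc by (simp add: pr_def distrib_left)
    have 4: "norm ((1 / dt) *\<^sub>R (z0 - x0 $ i)) \<le> d / dt"
      using dz0 step by (simp add: divide_right_mono)
    let ?a = "f i (chi t # zs) - f i (pr nb i (($) (x t)))" and ?b = "(1 / dt) *\<^sub>R (z0 - x0 $ i)"
    have qt: "q t = ?a + ?b + w i" by (simp add: q_def)
    have "norm (q t) \<le> norm ?a + norm ?b + norm (w i)"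
      unfolding qt using norm_triangle_ineq[of "?a + ?b" "w i"] norm_triangle_ineq[of ?a ?b] by linarith
    also have "\<dots> \<le> (L2 * (M * dt) + L2 * norm (e t) + L1 * (sqrt (real (length (nb i))) * (3 * M * dt)))
        + d / dt + lam * vmax"
      using 3 4 wi by (intro add_mono)
    also have "\<dots> \<le> vmax + L2 * norm (e t)"
      using small_div[of i] left_diff_distrib[of 1 lam vmax] by (simp add: d_def)
    finally show ?thesis .
  qed
  \<comment> \<open>The derivative of \<open>e\<close> is the saturation error, which by
    \<open>qbound\<close> is at most \<open>L2 * norm (e t)\<close>.\<close>
  have "norm (e dt) \<le> exp (L2 * (dt - 0)) * norm (e 0)"
  proof (rule gronwall_norm(1)[where e' = "\<lambda>t. closest_point (cball 0 vmax) (q t) - q t"])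
    fix t assume t: "t \<in> {0..dt}"
    have "((\<lambda>s. x s $ i) has_vector_derivative (F (x t) + ?V t (x t)) $ i) (at t within {0..dt})"
      using ode_solutionD(2)[OF x(2) t] unfolding has_vector_derivative_cart by blast
    hence 1: "((\<lambda>s. x s $ i) has_vector_derivative f i (pr nb i (($) (x t))) + closest_point (cball 0 vmax) (q t))
        (at t within {0..dt})"
      using input_i[OF t] by (simp add: F_def)
    have 2: "(p has_vector_derivative f i (chi t # zs) + (1 / dt) *\<^sub>R (z0 - x0 $ i) + w i) (at t within {0..dt})"
    proof -
      let ?c = "(1 / dt) *\<^sub>R (z0 - x0 $ i) + w i"
      have "((\<lambda>s. s *\<^sub>R ?c) has_vector_derivative ?c) (at t within {0..dt})"
        unfolding has_vector_derivative_def by (intro has_derivative_scaleR_left has_derivative_ident)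
      from has_vector_derivative_add[OF ode_solutionD(2)[OF csol t] this]
      have "((\<lambda>s. (x0 $ i - z0) + (chi s + s *\<^sub>R ?c)) has_vector_derivative 0 + (f i (chi t # zs) + ?c)) (at t within {0..dt})"
        by (rule has_vector_derivative_add[OF has_vector_derivative_const])
      moreover have "p = (\<lambda>s. (x0 $ i - z0) + (chi s + s *\<^sub>R ?c))"
        by (auto simp: p_def algebra_simps)
      ultimately show ?thesis by (simp add: add.assoc)
    qed
    show "(e has_vector_derivative closest_point (cball 0 vmax) (q t) - q t) (at t within {0..dt})"
      unfolding e_def using has_vector_derivative_diff[OF 1 2] by (simp add: q_def algebra_simps)
    show "norm (closest_point (cball 0 vmax) (q t) - q t) \<le> L2 * norm (e t)"
      using gains by (intro norm_closest_point_diff_le qbound t) auto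
  qed (use step in auto)
  moreover have "e 0 = 0" by (simp add: e_def p_def chi0 x(1))
  ultimately have "x dt $ i = p dt" by (simp add: e_def)
  thus "x dt $ i = chi dt + dt *\<^sub>R w i" using step by (simp add: p_def)
qed

section \<open>Reachable points and successor cells\<close>

lemma cells_tuple:
  assumes "li \<in> tuples I (Suc (length (nb i)))" "list_all2 (\<lambda>x l. x \<in> S l) z li"
  shows "z \<in> tuples D (Suc (length (nb i)))"
proof -
  have "z ! j \<in> D" if j: "j < length z" for j
  proof -
    have "li ! j \<in> I"
      using nth_mem[of j li] j list_all2_lengthD[OF assms(2)] assms(1) by (auto simp: tuples_def)
    thus ?thesis using list_all2_nthD[OF assms(2) j] cell_subset by blast
  qed
  thus ?thesis using assms list_all2_lengthD[OF assms(2)]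
    by (auto simp: tuples_def in_set_conv_nth)
qed

text \<open>Each point of the ball is the end point of component \<open>i\<close> of a closed loop
  solution, and solutions stay in \<open>D\<close>.\<close>

lemma reachable_ball_subset:
  assumes li: "li \<in> tuples I (Suc (length (nb i)))" and z: "list_all2 (\<lambda>x l. x \<in> S l) z li"
    and chi: "reference_solution f D i z {0..dt} chi"
  shows "cball (chi dt) (lam * vmax * dt) \<subseteq> D"
proof
  fix v assume v: "v \<in> cball (chi dt) (lam * vmax * dt)"
  define w where "w = (1 / dt) *\<^sub>R (v - chi dt)"
  have w: "w \<in> W"
    using v step by (simp add: w_def dist_norm norm_minus_commute pos_divide_le_eq)
  have len: "length z = Suc (length (nb i))" "length li = Suc (length (nb i))"
    using li list_all2_lengthD[OF z] by (auto simp: tuples_def)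
  \<comment> \<open>Extending points and cells as pairs keeps each initial state in the cell
    assigned to its agent.\<close>
  let ?A = "{(x, l). l \<in> I \<and> x \<in> S l}"
  have "set (zip z li) \<subseteq> ?A"
    using z li unfolding list_all2_iff tuples_def by (fastforce dest: set_zip_rightD)
  moreover have "?A \<noteq> {}" using cell_point by blast
  ultimately obtain g where g: "\<And>m. g m \<in> ?A" "pr nb i g = zip z li"
    using pr_extend[of "zip z li" i ?A] len by auto
  define x0 :: "real^'n^'k" where "x0 = (\<chi> m. fst (g m))"
  define l where "l m = snd (g m)" for m
  have "pr nb i l = map snd (zip z li)" unfolding g(2)[symmetric] by (simp add: pr_def l_def)
  hence prl: "pr nb i l = li" using len by simp
  define Kf where "Kf m = (if m = i then tracking_law i z chi
      else \<lparr>horizon = (\<lambda>x0 w. \<infinity>), feedback = (\<lambda>x0 w t y. 0)\<rparr>)" for m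
  have lI: "l m \<in> I" and xS: "x0 $ m \<in> S (l m)" for m
    using g(1)[of m] by (auto simp: l_def x0_def)
  have P: "property_P D S M vmax dt W (pr nb m l) (Kf m)" for m
    using zero_law_property_P tracking_law_property_P[OF cells_tuple[OF li z] len(2) chi]
    by (auto simp: Kf_def prl)
  have Ki: "Kf i = tracking_law i z chi" by (simp add: Kf_def)
  note tr = tracking[where l = l and Kf = Kf and w = "\<lambda>_. w" and ?x0.0 = x0, OF lI prl z chi Ki P w xS]
  obtain x where x: "closed_loop_solution nb f D dt Kf (\<lambda>_. w) x0 x" using tr(1) by blast
  have "x dt $ i = v" using tr(2)[OF x] step by (simp add: w_def)
  moreover have "x dt $ i \<in> D"
    using x step unfolding closed_loop_solution_def mas_solution_def by auto
  ultimately show "v \<in> D" by simp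
qed

text \<open>A point \<open>v\<close> of the cell within the ball determines \<open>wi\<close>, and
  by \<open>tracking\<close> agent \<open>i\<close> ends exactly at \<open>v\<close> whatever the
  other agents do, as Condition (C) demands.\<close>

lemma reachable_cells_subset_Post:
  assumes li: "li \<in> tuples I (Suc (length (nb i)))" and z: "list_all2 (\<lambda>x l. x \<in> S l) z li"
    and chi: "reference_solution f D i z {0..dt} chi"
  shows "{l\<in>I. S l \<inter> cball (chi dt) (lam * vmax * dt) \<noteq> {}} \<subseteq> Post nb f D I S M vmax dt W i li"
proof
  fix l' assume "l' \<in> {l\<in>I. S l \<inter> cball (chi dt) (lam * vmax * dt) \<noteq> {}}"
  then obtain v where l': "l' \<in> I" "v \<in> S l'" and v: "v \<in> cball (chi dt) (lam * vmax * dt)" by blast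
  define wi where "wi = (1 / dt) *\<^sub>R (v - chi dt)"
  have wi: "wi \<in> W"
    using v step by (simp add: wi_def dist_norm norm_minus_commute pos_divide_le_eq)
  have len: "length li = Suc (length (nb i))" using li by (simp add: tuples_def)
  have P: "property_P D S M vmax dt W li (tracking_law i z chi)"
    by (rule tracking_law_property_P[OF cells_tuple[OF li z] len chi])
  have "condition_C nb f D I S M vmax dt W i li (tracking_law i z chi) wi l'"
    unfolding condition_C_def
  proof (intro allI impI, elim conjE)
    fix l Kf w and x0 :: "real^'n^'k"
    assume h: "\<forall>m. l m \<in> I" "pr nb i l = li" "Kf i = tracking_law i z chi" "w i = wi"
      "\<forall>m. m \<noteq> i \<longrightarrow> property_P D S M vmax dt W (pr nb m l) (Kf m) \<and> w m \<in> W"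
      "\<forall>m. x0 $ m \<in> D \<and> x0 $ m \<in> S (l m)"
    have lI: "l m \<in> I" and Pm: "property_P D S M vmax dt W (pr nb m l) (Kf m)" and wm: "w m \<in> W"
      and xS: "x0 $ m \<in> S (l m)" for m
      using h P wi by (cases "m = i"; auto)+
    note tr = tracking[where l = l and Kf = Kf and w = w and ?x0.0 = x0, OF lI h(2) z chi h(3) Pm wm xS]
    have "chi dt + dt *\<^sub>R w i = v" using step by (simp add: h(4) wi_def)
    thus "(\<exists>x. closed_loop_solution nb f D dt Kf w x0 x) \<and>
        (\<forall>x. closed_loop_solution nb f D dt Kf w x0 x \<longrightarrow> x dt $ i \<in> S l')"
      using tr l'(2) by auto
  qed
  thus "l' \<in> Post nb f D I S M vmax dt W i li"
    using l' wi P unfolding Post_def well_posed_transition_def by blast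
qed

lemma trajectory_on_step:
  assumes "z \<in> tuples D (Suc (length (nb i)))" "reference_trajectory f D i z J chi"
  shows "{0..dt} \<subseteq> J" "reference_solution f D i z {0..dt} chi"
proof -
  obtain chi0 where "reference_solution f D i z {0..dt} chi0"
    using reference_solution_on_step[OF assms(1)] by blast
  thus J: "{0..dt} \<subseteq> J" using reference_trajectory_covers[OF assms(1) _ _ assms(2)] step by simp
  show "reference_solution f D i z {0..dt} chi"
    using assms(2) step ode_solution_subset[OF _ J]
    unfolding reference_trajectory_def reference_solution_iff by (auto simp: is_interval_cc)
qed

text \<open>For any choice of reference points in the cells, \<open>chi dt\<close> lies in
  \<open>D\<close>, hence in some cell, and that cell meets the ball at its center.\<close>

lemma Post_nonempty:
  assumes li: "li \<in> tuples I (Suc (length (nb i)))"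
  shows "Post nb f D I S M vmax dt W i li \<noteq> {}"
proof -
  define z where "z = map (\<lambda>l. SOME x. x \<in> S l) li"
  have "(SOME x. x \<in> S l) \<in> S l" if "l \<in> set li" for l
    using that li cells unfolding cell_decomposition_def tuples_def by (auto intro!: some_in_eq[THEN iffD2])
  hence z: "list_all2 (\<lambda>x l. x \<in> S l) z li" by (auto simp: z_def list_all2_conv_all_nth)
  obtain chi where chi: "reference_solution f D i z {0..dt} chi"
    using reference_solution_on_step[OF cells_tuple[OF li z]] by blast
  have "chi dt \<in> D" using chi step by (auto simp: reference_solution_def)
  then obtain l where "l \<in> I" "chi dt \<in> S l" using cells unfolding cell_decomposition_def by blast
  hence "l \<in> {l\<in>I. S l \<inter> cball (chi dt) (lam * vmax * dt) \<noteq> {}}" using lam gains step by auto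
  thus ?thesis using reachable_cells_subset_Post[OF li z chi] by blast
qed

end

theorem theorem6p3:
  fixes nb :: "'k::finite \<Rightarrow> 'k list"
    and f :: "'k \<Rightarrow> (real^'n) list \<Rightarrow> real^'n"
    and D :: "(real^'n) set"
    and I :: "'l set" and S :: "'l \<Rightarrow> (real^'n) set"
    and W :: "(real^'n) set"
    and M vmax L1 L2 L dt lam mu r :: real
  assumes "multi_agent_system nb f D M vmax L1 L2"
    and "cell_decomposition D I S"
    and "dt > 0" and "0 < lam" and "lam < 1" and "mu > 0"
    and "W = cball 0 (lam * vmax)"
    and "L = Max (range (\<lambda>i. 3 * L2 + 4 * L1 * sqrt (real (length (nb i)))))"
    and "r = lam * vmax * dt"
    and "condition_I lam mu vmax M L (d_max I S) dt \<or>
         condition_II lam mu vmax M L (d_max I S) dt \<or>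
         condition_III lam mu vmax M L (d_max I S) dt"
  shows "(\<forall>i. \<forall>li\<in>tuples I (Suc (length (nb i))).
            Post nb f D I S M vmax dt W i li \<noteq> {}) \<and>
         well_posed_discretization nb f D I S M vmax dt W \<and>
         (\<forall>i. \<forall>li\<in>tuples I (Suc (length (nb i))).
            \<forall>z. list_all2 (\<lambda>x l. x \<in> S l) z li \<longrightarrow>
              (\<exists>J chi. reference_trajectory f D i z J chi) \<and>
              (\<forall>J chi. reference_trajectory f D i z J chi \<longrightarrow>
                 {0..dt} \<subseteq> J \<and>
                 cball (chi dt) r \<subseteq> D \<and>
                 {l\<in>I. S l \<inter> cball (chi dt) r \<noteq> {}} \<subseteq> Post nb f D I S M vmax dt W i li))"
proof -
  interpret mas nb f D M vmax L1 L2 by unfold_locales fact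
  have L_ge: "3 * L2 + 4 * L1 * sqrt (real (length (nb i))) \<le> L" for i
    unfolding assms(8) by (rule Max_ge) auto
  have gain_le: "L2 + 3 * L1 * sqrt (real (length (nb i))) \<le> L" for i
  proof -
    have "0 \<le> L1 * sqrt (real (length (nb i)))" using gains by simp
    thus ?thesis using L_ge[of i] gains by linarith
  qed
  \<comment> \<open>\<open>undefined\<close> stands for an arbitrary agent; one agent suffices to
    see that the maximum is positive.\<close>
  have "0 < 3 * L2 + 4 * L1 * sqrt (real (length (nb undefined)))"
    using gains by (intro add_pos_nonneg) auto
  hence L: "0 < L" using L_ge[of undefined] by linarith
  have "M * L * dt\<^sup>2 + d_max I S \<le> (1 - lam) * vmax * dt"
    using gains assms L by (intro step_condition[of M L vmax lam mu]) auto
  moreover have "M * (L2 + 3 * L1 * sqrt (real (length (nb i)))) * dt\<^sup>2 \<le> M * L * dt\<^sup>2" for i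
    using gain_le[of i] gains by (intro mult_right_mono mult_left_mono) auto
  ultimately interpret discretized_mas nb f D M vmax L1 L2 I S dt lam
    using assms by unfold_locales (auto intro: order_trans[OF add_right_mono])
  have W: "W = cball 0 (lam * vmax)" by fact
  note post = Post_nonempty[folded W]
  have "well_posed_discretization nb f D I S M vmax dt W"
    using post unfolding well_posed_discretization_def Post_def by blast
  moreover have "(\<exists>J chi. reference_trajectory f D i z J chi) \<and>
      (\<forall>J chi. reference_trajectory f D i z J chi \<longrightarrow>
         {0..dt} \<subseteq> J \<and> cball (chi dt) r \<subseteq> D \<and>
         {l\<in>I. S l \<inter> cball (chi dt) r \<noteq> {}} \<subseteq> Post nb f D I S M vmax dt W i li)"
    if li: "li \<in> tuples I (Suc (length (nb i)))" and z: "list_all2 (\<lambda>x l. x \<in> S l) z li" for i li z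
  proof (intro conjI allI impI)
    show "\<exists>J chi. reference_trajectory f D i z J chi"
      by (rule reference_trajectory_exists[OF cells_tuple[OF li z]])
    fix J chi assume chi: "reference_trajectory f D i z J chi"
    note step_chi = trajectory_on_step[OF cells_tuple[OF li z] chi]
    show "{0..dt} \<subseteq> J" by (rule step_chi(1))
    show "cball (chi dt) r \<subseteq> D"
      using reachable_ball_subset[OF li z step_chi(2)] by (simp add: assms(9))
    show "{l\<in>I. S l \<inter> cball (chi dt) r \<noteq> {}} \<subseteq> Post nb f D I S M vmax dt W i li"
      using reachable_cells_subset_Post[OF li z step_chi(2)] by (simp add: assms(9) W)
  qed
  ultimately show ?thesis using post by blast
qed

end
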